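(* Let $M_k$ be a cohopfian right module over a ring $k$ which has the finite exchange property. Then $M$ has the countable ($\aleph_0$-)exchange property.
   Context: A module is cohopfian if every injective endomorphism of it is an automorphism. For a cardinal $\aleph$, a module $M_k$ has the $\aleph$-exchange property if whenever $A=M\oplus N=\bigoplus_{i\in I}A_i$ (internal direct sums of submodules of a module $A$) with $|I|\le\aleph$, there are submodules $A_i'\subseteq A_i$ such that $A=M\oplus\bigoplus_{i\in I}A_i'$. Finite exchange means $\aleph$-exchange for every finite cardinal $\aleph$; countable exchange means $\aleph_0$-exchange. *)

theory Defs
  imports "HOL-Algebra.Ring" "HOL-Library.Countable_Set"
begin

text \<open>A right module over a ring R: an additive abelian group (the ring-record fields
  add and zero of M; the mult and one fields of M are unused) with a right scalar action.\<close>

record ('m, 'r) rmodule = "'m ring" +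
  ract :: "'m \<Rightarrow> 'r \<Rightarrow> 'm"

definition right_module :: "('r, 'c) ring_scheme \<Rightarrow> ('m, 'r, 'd) rmodule_scheme \<Rightarrow> bool" where
  "right_module R M \<longleftrightarrow> ring R \<and> abelian_group M \<and>
     (\<forall>x\<in>carrier M. \<forall>r\<in>carrier R. ract M x r \<in> carrier M) \<and>
     (\<forall>x\<in>carrier M. \<forall>y\<in>carrier M. \<forall>r\<in>carrier R.
        ract M (x \<oplus>\<^bsub>M\<^esub> y) r = ract M x r \<oplus>\<^bsub>M\<^esub> ract M y r) \<and>
     (\<forall>x\<in>carrier M. \<forall>r\<in>carrier R. \<forall>s\<in>carrier R.
        ract M x (r \<oplus>\<^bsub>R\<^esub> s) = ract M x r \<oplus>\<^bsub>M\<^esub> ract M x s) \<and>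
     (\<forall>x\<in>carrier M. \<forall>r\<in>carrier R. \<forall>s\<in>carrier R.
        ract M x (r \<otimes>\<^bsub>R\<^esub> s) = ract M (ract M x r) s) \<and>
     (\<forall>x\<in>carrier M. ract M x \<one>\<^bsub>R\<^esub> = x)"

definition rsubmodule :: "('r, 'c) ring_scheme \<Rightarrow> ('m, 'r, 'd) rmodule_scheme \<Rightarrow> 'm set \<Rightarrow> bool" where
  "rsubmodule R A S \<longleftrightarrow> S \<subseteq> carrier A \<and> \<zero>\<^bsub>A\<^esub> \<in> S \<and>
     (\<forall>x\<in>S. \<forall>y\<in>S. x \<oplus>\<^bsub>A\<^esub> y \<in> S) \<and> (\<forall>x\<in>S. \<ominus>\<^bsub>A\<^esub> x \<in> S) \<and>
     (\<forall>x\<in>S. \<forall>r\<in>carrier R. ract A x r \<in> S)"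

definition rmod_hom :: "('r, 'c) ring_scheme \<Rightarrow> ('m, 'r, 'd) rmodule_scheme \<Rightarrow>
    ('n, 'r, 'e) rmodule_scheme \<Rightarrow> ('m \<Rightarrow> 'n) \<Rightarrow> bool" where
  "rmod_hom R M N f \<longleftrightarrow> f \<in> carrier M \<rightarrow> carrier N \<and>
     (\<forall>x\<in>carrier M. \<forall>y\<in>carrier M. f (x \<oplus>\<^bsub>M\<^esub> y) = f x \<oplus>\<^bsub>N\<^esub> f y) \<and>
     (\<forall>x\<in>carrier M. \<forall>r\<in>carrier R. f (ract M x r) = ract N (f x) r)"

definition cohopfian :: "('r, 'c) ring_scheme \<Rightarrow> ('m, 'r, 'd) rmodule_scheme \<Rightarrow> bool" where
  "cohopfian R M \<longleftrightarrow> (\<forall>f. rmod_hom R M M f \<and> inj_on f (carrier M)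
       \<longrightarrow> bij_betw f (carrier M) (carrier M))"

definition inner_dsum :: "('m, 'b) ring_scheme \<Rightarrow> 'i set \<Rightarrow> ('i \<Rightarrow> 'm set) \<Rightarrow> bool" where
  "inner_dsum A I S \<longleftrightarrow>
     (\<forall>a\<in>carrier A. \<exists>F x. finite F \<and> F \<subseteq> I \<and> (\<forall>i\<in>F. x i \<in> S i) \<and> a = finsum A x F) \<and>
     (\<forall>F x. finite F \<and> F \<subseteq> I \<and> (\<forall>i\<in>F. x i \<in> S i) \<and> finsum A x F = \<zero>\<^bsub>A\<^esub>
        \<longrightarrow> (\<forall>i\<in>F. x i = \<zero>\<^bsub>A\<^esub>))"

text \<open>Exchange property of M relative to index sets satisfying P (index sets are subsets of nat,
  which covers all index sets of cardinality at most aleph_0 up to reindexing), with ambient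
  modules A whose elements live in the type 'a. The module M is placed inside A via an
  injective homomorphism f, so that f(M) is a submodule of A with A = f(M) (+) N.\<close>
definition has_exchange :: "('r, 'c) ring_scheme \<Rightarrow> ('m, 'r, 'd) rmodule_scheme \<Rightarrow>
    'a itself \<Rightarrow> (nat set \<Rightarrow> bool) \<Rightarrow> bool" where
  "has_exchange R M _ P \<longleftrightarrow>
     (\<forall>(A :: ('a, 'r) rmodule) f N (I :: nat set) Ai.
        right_module R A \<and> rmod_hom R M A f \<and> inj_on f (carrier M) \<and>
        rsubmodule R A N \<and>
        inner_dsum A (UNIV :: bool set) (\<lambda>b. if b then f ` carrier M else N) \<and>
        P I \<and> (\<forall>i\<in>I. rsubmodule R A (Ai i)) \<and> inner_dsum A I Ai
        \<longrightarrow> (\<exists>Ai'. (\<forall>i\<in>I. rsubmodule R A (Ai' i) \<and> Ai' i \<subseteq> Ai i) \<and>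
               inner_dsum A (insert None (Some ` I))
                 (\<lambda>j. case j of None \<Rightarrow> f ` carrier M | Some i \<Rightarrow> Ai' i)))"

abbreviation finite_exchange where
  "finite_exchange R M T \<equiv> has_exchange R M T finite"

abbreviation countable_exchange where
  "countable_exchange R M T \<equiv> has_exchange R M T (\<lambda>I. countable I)"

end

theory Submission
  imports Defs
begin

text \<open>
  Let \<open>\<iota> : M \<rightarrow> A\<close> be the embedding and \<open>\<pi>\<^sub>n\<close> the projection of \<open>A\<close> onto \<open>A\<^sub>n\<close>. Finite exchange
  yields, one index at a time, homomorphisms \<open>c\<^sub>n : A \<rightarrow> M\<close> such that the endomorphisms
  \<open>e\<^sub>n = c\<^sub>n \<pi>\<^sub>n \<iota>\<close> are idempotent and \<open>e\<^sub>i c\<^sub>k = 0\<close> for \<open>i < k\<close>; in general they are not orthogonal,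
  since the later steps disturb the earlier ones. By triangularity the images of the \<open>c\<^sub>n\<close> are
  independent, so \<open>s = \<Sum> c\<^sub>n \<pi>\<^sub>n\<close> kills \<open>a\<close> only if every \<open>c\<^sub>n \<pi>\<^sub>n\<close> does. As \<open>\<Inter> ker e\<^sub>n = 0\<close>, the
  endomorphism \<open>s \<iota>\<close> is injective, hence bijective because \<open>M\<close> is cohopfian. Therefore
  \<open>A = \<iota> M \<oplus> ker s\<close>, and \<open>ker s\<close> is the direct sum of the submodules \<open>A\<^sub>n \<inter> ker c\<^sub>n\<close>.
\<close>

subsection \<open>Modules and homomorphisms\<close>

locale rmod =
  fixes R :: "('r, 'c) ring_scheme" and M :: "('m, 'r, 'd) rmodule_scheme"
  assumes right_module: "right_module R M"

sublocale rmod \<subseteq> abelian_group M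
  using right_module by (simp add: right_module_def)

context rmod
begin

lemma ract_closed: "x \<in> carrier M \<Longrightarrow> r \<in> carrier R \<Longrightarrow> ract M x r \<in> carrier M"
  and ract_add: "x \<in> carrier M \<Longrightarrow> y \<in> carrier M \<Longrightarrow> r \<in> carrier R \<Longrightarrow>
    ract M (x \<oplus>\<^bsub>M\<^esub> y) r = ract M x r \<oplus>\<^bsub>M\<^esub> ract M y r"
  using right_module by (simp_all add: right_module_def)

lemma ract_zero: "r \<in> carrier R \<Longrightarrow> ract M \<zero>\<^bsub>M\<^esub> r = \<zero>\<^bsub>M\<^esub>"
  using ract_add[of "\<zero>\<^bsub>M\<^esub>" "\<zero>\<^bsub>M\<^esub>" r] ract_closed[of "\<zero>\<^bsub>M\<^esub>" r] by simp

lemma ract_finsum: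
  assumes "r \<in> carrier R" "finite F" "x \<in> F \<rightarrow> carrier M"
  shows "ract M (finsum M x F) r = finsum M (\<lambda>i. ract M (x i) r) F"
  using assms(2,3)
proof (induction F rule: finite_induct)
  case empty
  then show ?case using assms(1) by (simp add: ract_zero)
next
  case (insert i F)
  then have "x i \<in> carrier M" "x \<in> F \<rightarrow> carrier M" "(\<lambda>i. ract M (x i) r) \<in> F \<rightarrow> carrier M"
    using assms(1) by (auto intro!: ract_closed)
  then show ?case
    using insert assms(1) by (simp add: ract_add ract_closed)
qed

lemma finsum_superset:
  assumes "finite G" "F \<subseteq> G" "x \<in> F \<rightarrow> carrier M" "\<And>i. i \<in> G - F \<Longrightarrow> x i = \<zero>\<^bsub>M\<^esub>"
  shows "finsum M x G = finsum M x F"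
proof -
  have "x \<in> G \<rightarrow> carrier M"
  proof
    fix i assume "i \<in> G"
    then show "x i \<in> carrier M" using assms by (cases "i \<in> F") auto
  qed
  then show ?thesis
    using add.finprod_mono_neutral_cong_left[of G F x x] assms by auto
qed

lemma minus_minus_self: "x \<in> carrier M \<Longrightarrow> y \<in> carrier M \<Longrightarrow> (x \<ominus>\<^bsub>M\<^esub> y) \<oplus>\<^bsub>M\<^esub> y = x"
  by (simp add: minus_eq a_assoc l_neg)

lemma minus_zero: "x \<in> carrier M \<Longrightarrow> x \<ominus>\<^bsub>M\<^esub> \<zero>\<^bsub>M\<^esub> = x"
  by (simp add: minus_eq)

lemma minus_eq_zero_iff: "x \<in> carrier M \<Longrightarrow> y \<in> carrier M \<Longrightarrow> x \<ominus>\<^bsub>M\<^esub> y = \<zero>\<^bsub>M\<^esub> \<longleftrightarrow> x = y"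
  by (metis minus_minus_self l_zero minus_eq r_neg)

lemma eq_minus_of_add: "x \<in> carrier M \<Longrightarrow> y \<in> carrier M \<Longrightarrow> z \<in> carrier M \<Longrightarrow> x \<oplus>\<^bsub>M\<^esub> y = z \<Longrightarrow>
    x = z \<ominus>\<^bsub>M\<^esub> y"
  by (auto simp add: minus_eq a_assoc r_neg)

end

lemma rmod_hom_closed: "rmod_hom R M N f \<Longrightarrow> x \<in> carrier M \<Longrightarrow> f x \<in> carrier N"
  and rmod_hom_add: "rmod_hom R M N f \<Longrightarrow> x \<in> carrier M \<Longrightarrow> y \<in> carrier M \<Longrightarrow>
    f (x \<oplus>\<^bsub>M\<^esub> y) = f x \<oplus>\<^bsub>N\<^esub> f y"
  and rmod_hom_ract: "rmod_hom R M N f \<Longrightarrow> x \<in> carrier M \<Longrightarrow> r \<in> carrier R \<Longrightarrow>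
    f (ract M x r) = ract N (f x) r"
  by (auto simp: rmod_hom_def)

lemma rmod_hom_compose:
  "rmod_hom R M N f \<Longrightarrow> rmod_hom R N L g \<Longrightarrow> rmod_hom R M L (\<lambda>x. g (f x))"
  by (auto simp: rmod_hom_def Pi_iff)

lemma rmod_hom_ident: "rmod_hom R M M (\<lambda>x. x)"
  by (auto simp: rmod_hom_def)

locale rmod_pair = M: rmod R M + N: rmod R N
  for R :: "('r, 'c) ring_scheme" and M :: "('m, 'r, 'd) rmodule_scheme"
    and N :: "('n, 'r, 'e) rmodule_scheme"
begin

lemma hom_zero:
  assumes "rmod_hom R M N f" shows "f \<zero>\<^bsub>M\<^esub> = \<zero>\<^bsub>N\<^esub>"
  using rmod_hom_add[OF assms, of "\<zero>\<^bsub>M\<^esub>" "\<zero>\<^bsub>M\<^esub>"] rmod_hom_closed[OF assms, of "\<zero>\<^bsub>M\<^esub>"] by simp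

lemma hom_neg:
  assumes "rmod_hom R M N f" "x \<in> carrier M" shows "f (\<ominus>\<^bsub>M\<^esub> x) = \<ominus>\<^bsub>N\<^esub> f x"
proof -
  have "f (\<ominus>\<^bsub>M\<^esub> x) \<oplus>\<^bsub>N\<^esub> f x = \<zero>\<^bsub>N\<^esub>"
    using rmod_hom_add[OF assms(1), of "\<ominus>\<^bsub>M\<^esub> x" x] assms hom_zero by (simp add: M.l_neg)
  then show ?thesis
    using assms N.minus_equality[of "f (\<ominus>\<^bsub>M\<^esub> x)" "f x"] by (simp add: rmod_hom_closed)
qed

lemma hom_minus:
  "rmod_hom R M N f \<Longrightarrow> x \<in> carrier M \<Longrightarrow> y \<in> carrier M \<Longrightarrow> f (x \<ominus>\<^bsub>M\<^esub> y) = f x \<ominus>\<^bsub>N\<^esub> f y"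
  by (simp add: M.minus_eq N.minus_eq hom_neg rmod_hom_add)

lemma hom_finsum:
  assumes "rmod_hom R M N f" "finite F" "x \<in> F \<rightarrow> carrier M"
  shows "f (finsum M x F) = finsum N (\<lambda>i. f (x i)) F"
  using assms(2,3)
proof (induction F rule: finite_induct)
  case empty
  then show ?case using assms(1) by (simp add: hom_zero)
next
  case (insert i F)
  then have "x i \<in> carrier M" "x \<in> F \<rightarrow> carrier M" "(\<lambda>i. f (x i)) \<in> F \<rightarrow> carrier N"
    using rmod_hom_closed[OF assms(1)] by auto
  then show ?case
    using insert rmod_hom_add[OF assms(1)] rmod_hom_closed[OF assms(1)] by simp
qed

lemma zero_hom: "rmod_hom R M N (\<lambda>x. \<zero>\<^bsub>N\<^esub>)"
  by (auto simp: rmod_hom_def N.ract_zero)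

lemma add_hom:
  "rmod_hom R M N f \<Longrightarrow> rmod_hom R M N g \<Longrightarrow> rmod_hom R M N (\<lambda>x. f x \<oplus>\<^bsub>N\<^esub> g x)"
  by (auto simp: rmod_hom_def Pi_iff N.ract_add N.a_ac)

lemma minus_hom:
  assumes "rmod_hom R M N f" "rmod_hom R M N g"
  shows "rmod_hom R M N (\<lambda>x. f x \<ominus>\<^bsub>N\<^esub> g x)"
proof -
  have "ract N (\<ominus>\<^bsub>N\<^esub> y) r = \<ominus>\<^bsub>N\<^esub> ract N y r" if "y \<in> carrier N" "r \<in> carrier R" for y r
  proof -
    have "ract N (\<ominus>\<^bsub>N\<^esub> y) r \<oplus>\<^bsub>N\<^esub> ract N y r = \<zero>\<^bsub>N\<^esub>"
      using that by (metis N.a_inv_closed N.l_neg N.ract_add N.ract_zero)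
    then show ?thesis
      using that by (metis N.a_inv_closed N.minus_equality N.ract_closed)
  qed
  then have "rmod_hom R M N (\<lambda>x. \<ominus>\<^bsub>N\<^esub> g x)"
    using assms(2) by (auto simp: rmod_hom_def Pi_iff N.minus_add)
  from add_hom[OF assms(1) this] show ?thesis
    by (simp add: N.minus_eq)
qed

lemma image_rsubmodule:
  assumes "rmod_hom R M N f" shows "rsubmodule R N (f ` carrier M)"
  unfolding rsubmodule_def
proof (intro conjI ballI)
  show "f ` carrier M \<subseteq> carrier N"
    using assms by (auto simp: rmod_hom_closed)
  show "\<zero>\<^bsub>N\<^esub> \<in> f ` carrier M"
    using hom_zero[OF assms] by (metis M.zero_closed imageI)
  fix x assume "x \<in> f ` carrier M"
  then obtain x' where x': "x' \<in> carrier M" "x = f x'" by auto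
  show "\<ominus>\<^bsub>N\<^esub> x \<in> f ` carrier M"
    using x' hom_neg[OF assms] by (metis M.a_inv_closed imageI)
  show "ract N x r \<in> f ` carrier M" if "r \<in> carrier R" for r
    using x' rmod_hom_ract[OF assms] that by (metis M.ract_closed imageI)
  fix y assume "y \<in> f ` carrier M"
  then obtain y' where y': "y' \<in> carrier M" "y = f y'" by auto
  show "x \<oplus>\<^bsub>N\<^esub> y \<in> f ` carrier M"
    using x' y' rmod_hom_add[OF assms] by (metis M.a_closed imageI)
qed

lemma kernel_rsubmodule:
  assumes "rmod_hom R M N f" "rsubmodule R M S" shows "rsubmodule R M {x \<in> S. f x = \<zero>\<^bsub>N\<^esub>}"
proof -
  have "S \<subseteq> carrier M" using assms(2) by (simp add: rsubmodule_def)
  then show ?thesis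
    using assms(2) hom_zero[OF assms(1)] rmod_hom_add[OF assms(1)] hom_neg[OF assms(1)]
      rmod_hom_ract[OF assms(1)]
    by (auto simp: rsubmodule_def subset_iff N.ract_zero)
qed

text \<open>At each element only finitely many \<open>f i\<close> contribute, so an identity
  involving finitely many elements can be checked on one common initial segment
  \<open>{..<n}\<close>, where it concerns finite sums. This gives a meaning to the infinite sum of
  the \<open>c\<^sub>n \<pi>\<^sub>n\<close>.\<close>

lemma sum_hom:
  assumes hom: "\<And>i. rmod_hom R M N (f i)"
    and fin: "\<And>x. x \<in> carrier M \<Longrightarrow> \<exists>n::nat. \<forall>i\<ge>n. f i x = \<zero>\<^bsub>N\<^esub>"
  obtains s where "rmod_hom R M N s"
    and "\<And>x n. x \<in> carrier M \<Longrightarrow> (\<And>i. i \<ge> n \<Longrightarrow> f i x = \<zero>\<^bsub>N\<^esub>) \<Longrightarrow> s x = finsum N (\<lambda>i. f i x) {..<n}"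
proof -
  \<comment> \<open>Summing over the exact support makes the value independent of a choice of bound;
    \<open>eq\<close> then admits every bound beyond the support.\<close>
  define s where "s x = finsum N (\<lambda>i. f i x) {i. f i x \<noteq> \<zero>\<^bsub>N\<^esub>}" for x
  have eq: "s x = finsum N (\<lambda>i. f i x) {..<n}"
    if "x \<in> carrier M" "\<And>i. i \<ge> n \<Longrightarrow> f i x = \<zero>\<^bsub>N\<^esub>" for x n
    unfolding s_def
    by (intro N.finsum_superset[symmetric])
      (use that rmod_hom_closed[OF hom] in \<open>auto simp: not_less[symmetric]\<close>)
  have "rmod_hom R M N s"
    unfolding rmod_hom_def
  proof (intro conjI ballI funcsetI)
    fix x assume x: "x \<in> carrier M"
    then obtain n where n: "\<And>i. i \<ge> n \<Longrightarrow> f i x = \<zero>\<^bsub>N\<^esub>" using fin by blast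
    have P: "(\<lambda>i. f i x) \<in> {..<m} \<rightarrow> carrier N" for m
      using rmod_hom_closed[OF hom] x by auto
    show "s x \<in> carrier N"
      using eq[OF x n] P by simp
    show "s (ract M x r) = ract N (s x) r" if r: "r \<in> carrier R" for r
    proof -
      have "s (ract M x r) = finsum N (\<lambda>i. f i (ract M x r)) {..<n}"
        using x r n by (intro eq) (auto simp: M.ract_closed rmod_hom_ract[OF hom] N.ract_zero)
      also have "\<dots> = finsum N (\<lambda>i. ract N (f i x) r) {..<n}"
        using x r by (simp add: rmod_hom_ract[OF hom])
      also have "\<dots> = ract N (s x) r"
        using N.ract_finsum[OF r _ P] eq[OF x n] by simp
      finally show ?thesis .
    qed
    fix y assume y: "y \<in> carrier M"
    then obtain k where k: "\<And>i. i \<ge> k \<Longrightarrow> f i y = \<zero>\<^bsub>N\<^esub>" using fin by blast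
    have Q: "(\<lambda>i. f i y) \<in> {..<m} \<rightarrow> carrier N" for m
      using rmod_hom_closed[OF hom] y by auto
    let ?m = "max n k"
    have "s (x \<oplus>\<^bsub>M\<^esub> y) = finsum N (\<lambda>i. f i (x \<oplus>\<^bsub>M\<^esub> y)) {..<?m}"
      using x y n k by (intro eq) (auto simp: rmod_hom_add[OF hom])
    also have "\<dots> = finsum N (\<lambda>i. f i x \<oplus>\<^bsub>N\<^esub> f i y) {..<?m}"
      using x y by (simp add: rmod_hom_add[OF hom])
    also have "\<dots> = finsum N (\<lambda>i. f i x) {..<?m} \<oplus>\<^bsub>N\<^esub> finsum N (\<lambda>i. f i y) {..<?m}"
      using N.finsum_addf[OF P Q] .
    also have "\<dots> = s x \<oplus>\<^bsub>N\<^esub> s y"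
      using eq[OF x, of ?m] eq[OF y, of ?m] n k by simp
    finally show "s (x \<oplus>\<^bsub>M\<^esub> y) = s x \<oplus>\<^bsub>N\<^esub> s y" .
  qed
  with eq show ?thesis using that by blast
qed

end

subsection \<open>Direct sums and their projections\<close>

text \<open>A decomposition given by its coordinate projections, so that uniqueness of components
  becomes orthogonality of homomorphisms. The last clause asks only for some finite
  \<open>F\<close>; that the other coordinates vanish is a consequence.\<close>

definition dsum_projections :: "('r, 'c) ring_scheme \<Rightarrow> ('m, 'r, 'd) rmodule_scheme \<Rightarrow>
    'i set \<Rightarrow> ('i \<Rightarrow> 'm set) \<Rightarrow> ('i \<Rightarrow> 'm \<Rightarrow> 'm) \<Rightarrow> bool" where
  "dsum_projections R A I S P \<longleftrightarrow>
     (\<forall>i\<in>I. rmod_hom R A A (P i) \<and> (\<forall>a\<in>carrier A. P i a \<in> S i)) \<and>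
     (\<forall>i\<in>I. \<forall>k\<in>I. \<forall>x\<in>S k. P i x = (if i = k then x else \<zero>\<^bsub>A\<^esub>)) \<and>
     (\<forall>a\<in>carrier A. \<exists>F. finite F \<and> F \<subseteq> I \<and> a = finsum A (\<lambda>i. P i a) F)"

context rmod
begin

text \<open>For \<open>k\<close> outside \<open>F\<close>, applying \<open>P k\<close> to the finite
  expansion of \<open>a\<close> annihilates every term by orthogonality.\<close>

lemma dsum_projections_zero_outside:
  assumes P: "dsum_projections R M I S P" and a: "a \<in> carrier M"
  obtains F where "finite F" "F \<subseteq> I" "a = finsum M (\<lambda>i. P i a) F"
    "\<And>i. i \<in> I - F \<Longrightarrow> P i a = \<zero>\<^bsub>M\<^esub>"
proof -
  interpret MM: rmod_pair R M M by unfold_locales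
  obtain F where F: "finite F" "F \<subseteq> I" "a = finsum M (\<lambda>i. P i a) F"
    using P a unfolding dsum_projections_def by meson
  have hom: "rmod_hom R M M (P i)" and S: "P i a \<in> S i" if "i \<in> I" for i
    using P a that unfolding dsum_projections_def by auto
  have "P k a = \<zero>\<^bsub>M\<^esub>" if k: "k \<in> I - F" for k
  proof -
    have "P k a = P k (finsum M (\<lambda>i. P i a) F)"
      using F(3) by (rule arg_cong)
    also have "\<dots> = finsum M (\<lambda>i. P k (P i a)) F"
      using k F(1,2) hom a by (intro MM.hom_finsum) (auto intro!: rmod_hom_closed[OF hom])
    also have "\<dots> = finsum M (\<lambda>i. \<zero>\<^bsub>M\<^esub>) F"
    proof (rule finsum_cong')
      fix i assume "i \<in> F"
      then have "i \<in> I" "k \<in> I" "i \<noteq> k" using F(2) k by auto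
      then show "P k (P i a) = \<zero>\<^bsub>M\<^esub>"
        using P S[of i] unfolding dsum_projections_def by auto
    qed auto
    finally show ?thesis by (simp add: finsum_zero)
  qed
  with F that show ?thesis by blast
qed

text \<open>Expansions exist by the last clause of \<open>dsum_projections\<close>. Independence
  holds because \<open>P k\<close> sends a vanishing finite sum to its \<open>k\<close>-th
  term.\<close>

lemma inner_dsum_of_projections:
  assumes P: "dsum_projections R M I S P" and S: "\<And>i. i \<in> I \<Longrightarrow> S i \<subseteq> carrier M"
  shows "inner_dsum M I S"
  unfolding inner_dsum_def
proof (intro conjI ballI allI impI)
  fix a assume "a \<in> carrier M"
  then obtain F where F: "finite F" "F \<subseteq> I" "a = finsum M (\<lambda>i. P i a) F"
    using P unfolding dsum_projections_def by meson
  have "\<forall>i\<in>F. P i a \<in> S i"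
    using P \<open>a \<in> carrier M\<close> F unfolding dsum_projections_def by blast
  with F show "\<exists>F x. finite F \<and> F \<subseteq> I \<and> (\<forall>i\<in>F. x i \<in> S i) \<and> a = finsum M x F"
    by (intro exI[of _ F] exI[of _ "\<lambda>i. P i a"]) simp
next
  interpret MM: rmod_pair R M M by unfold_locales
  fix F x k assume *: "finite F \<and> F \<subseteq> I \<and> (\<forall>i\<in>F. x i \<in> S i) \<and> finsum M x F = \<zero>\<^bsub>M\<^esub>" and k: "k \<in> F"
  then have xc: "x \<in> F \<rightarrow> carrier M" using S by blast
  have hom: "rmod_hom R M M (P k)"
    using P * k unfolding dsum_projections_def by blast
  have Pk: "P k (x i) = (if i = k then x i else \<zero>\<^bsub>M\<^esub>)" if "i \<in> F" for i
  proof -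
    have "i \<in> I" "k \<in> I" "x i \<in> S i" using that * k by auto
    then show ?thesis using P unfolding dsum_projections_def by auto
  qed
  have "\<zero>\<^bsub>M\<^esub> = P k (finsum M x F)"
    using * MM.hom_zero[OF hom] by simp
  also have "\<dots> = finsum M (\<lambda>i. P k (x i)) F"
    using * xc hom by (intro MM.hom_finsum) auto
  also have "\<dots> = finsum M (\<lambda>i. P k (x i)) {k}"
    using * k xc Pk by (intro finsum_superset) auto
  also have "\<dots> = x k"
    using xc k Pk by (auto simp: Pi_iff)
  finally show "x k = \<zero>\<^bsub>M\<^esub>" by simp
qed

text \<open>Finite expansions are unique once padded by zeros, so coordinates are well defined. They
  are linear because adding or scaling expansions termwise yields expansions again.\<close>

lemma projections_of_inner_dsum:
  assumes dsum: "inner_dsum M I S" and S: "\<And>i. i \<in> I \<Longrightarrow> rsubmodule R M (S i)"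
  obtains P where "dsum_projections R M I S P"
proof -
  \<comment> \<open>The coefficients vanish off \<open>F\<close>, so expansions over different
    finite sets can be compared as functions, and \<open>F\<close> may be enlarged within
    \<open>I\<close>.\<close>
  define rep where "rep a F x \<longleftrightarrow> finite F \<and> F \<subseteq> I \<and> (\<forall>i\<in>F. x i \<in> S i) \<and>
    (\<forall>i. i \<notin> F \<longrightarrow> x i = \<zero>\<^bsub>M\<^esub>) \<and> a = finsum M x F" for a F x
  have Sc: "x i \<in> carrier M" if "i \<in> I" "x i \<in> S i" for i x
    using S[OF that(1)] that(2) by (auto simp: rsubmodule_def)
  have ex: "\<exists>F x. rep a F x" if a: "a \<in> carrier M" for a
  proof -
    obtain F x where F: "finite F" "F \<subseteq> I" "\<forall>i\<in>F. x i \<in> S i" "a = finsum M x F"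
      using dsum a unfolding inner_dsum_def by meson
    have "finsum M x F = finsum M (\<lambda>i. if i \<in> F then x i else \<zero>\<^bsub>M\<^esub>) F"
      using F Sc by (intro finsum_cong') auto
    then have "rep a F (\<lambda>i. if i \<in> F then x i else \<zero>\<^bsub>M\<^esub>)"
      using F by (auto simp: rep_def)
    then show ?thesis by blast
  qed
  have extend: "rep a G x" if "rep a F x" "F \<subseteq> G" "G \<subseteq> I" "finite G" for a F G x
  proof -
    have "finsum M x G = finsum M x F"
      using that Sc by (intro finsum_superset) (auto simp: rep_def)
    moreover have "x i \<in> S i" if "i \<in> G" for i
      using \<open>rep a F x\<close> that \<open>G \<subseteq> I\<close> S[of i] by (cases "i \<in> F") (auto simp: rep_def rsubmodule_def)
    ultimately show ?thesis
      using that by (auto simp: rep_def)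
  qed
  have common: "\<exists>H. rep a H x \<and> rep b H y" if xy: "rep a F x" "rep b G y" for a F x b G y
  proof -
    have "F \<union> G \<subseteq> I" "finite (F \<union> G)"
      using xy unfolding rep_def by blast+
    then show ?thesis
      using extend[OF xy(1), of "F \<union> G"] extend[OF xy(2), of "F \<union> G"] by blast
  qed
  have repc: "x \<in> F \<rightarrow> carrier M" "a \<in> carrier M" "x i \<in> carrier M" if "rep a F x" for a F x i
  proof -
    show "x \<in> F \<rightarrow> carrier M" using that Sc by (auto simp: rep_def)
    then show "a \<in> carrier M" using that by (auto simp: rep_def)
    show "x i \<in> carrier M" using that Sc by (cases "i \<in> F") (auto simp: rep_def)
  qed
  have uniq: "x = y" if xy: "rep a F x" "rep a G y" for a F x G y
  proof -
    obtain H where H: "rep a H x" "rep a H y" using common xy by blast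
    let ?z = "\<lambda>i. x i \<ominus>\<^bsub>M\<^esub> y i"
    have n: "(\<lambda>i. \<ominus>\<^bsub>M\<^esub> y i) \<in> H \<rightarrow> carrier M"
      using repc[OF H(2)] by auto
    interpret MM: rmod_pair R M M by unfold_locales
    \<comment> \<open>Negation is written as the homomorphism \<open>0 - x\<close>, so that
      \<open>hom_finsum\<close> carries it through the sum.\<close>
    have neg: "rmod_hom R M M (\<lambda>x. \<zero>\<^bsub>M\<^esub> \<ominus>\<^bsub>M\<^esub> x)"
      by (intro MM.minus_hom MM.zero_hom rmod_hom_ident)
    have "finsum M ?z H = finsum M x H \<oplus>\<^bsub>M\<^esub> finsum M (\<lambda>i. \<ominus>\<^bsub>M\<^esub> y i) H"
      unfolding minus_eq using finsum_addf[OF repc(1)[OF H(1)] n] .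
    also have "finsum M (\<lambda>i. \<ominus>\<^bsub>M\<^esub> y i) H = finsum M (\<lambda>i. \<zero>\<^bsub>M\<^esub> \<ominus>\<^bsub>M\<^esub> y i) H"
      using repc(3)[OF H(2)] by (simp add: minus_eq)
    also have "\<dots> = \<zero>\<^bsub>M\<^esub> \<ominus>\<^bsub>M\<^esub> finsum M y H"
      using MM.hom_finsum[OF neg _ repc(1)[OF H(2)]] H by (simp add: rep_def)
    also have "finsum M x H \<oplus>\<^bsub>M\<^esub> (\<zero>\<^bsub>M\<^esub> \<ominus>\<^bsub>M\<^esub> finsum M y H) = \<zero>\<^bsub>M\<^esub>"
      using H repc(2)[OF H(1)] by (simp add: rep_def minus_eq r_neg)
    finally have "finsum M ?z H = \<zero>\<^bsub>M\<^esub>" .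
    moreover have "?z i \<in> S i" if "i \<in> H" for i
      using that H S[of i] by (auto simp: rep_def rsubmodule_def minus_eq)
    moreover have "finite H" "H \<subseteq> I" using H by (auto simp: rep_def)
    ultimately have "\<forall>i\<in>H. ?z i = \<zero>\<^bsub>M\<^esub>"
      using spec[OF spec[OF conjunct2[OF dsum[unfolded inner_dsum_def]], of H], of ?z] by blast
    then have "x i = y i" for i
      using H repc(3)[OF H(1)] repc(3)[OF H(2)] minus_eq_zero_iff
      by (cases "i \<in> H") (auto simp: rep_def)
    then show "x = y" by blast
  qed
  define X where "X a = (SOME x. \<exists>F. rep a F x)" for a
  have X: "\<exists>F. rep a F (X a)" if "a \<in> carrier M" for a
    using ex[OF that] someI_ex[of "\<lambda>x. \<exists>F. rep a F x"] by (auto simp: X_def)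
  have XI: "X a = x" if "rep a F x" for a F x
    using X[of a] uniq that repc(2)[OF that] by blast
  define P where "P i a = X a i" for i a
  have PS: "P i a \<in> S i" if a: "a \<in> carrier M" and i: "i \<in> I" for i a
  proof -
    obtain F where "rep a F (X a)" using X[OF a] by blast
    then show ?thesis
      using S[OF i] by (cases "i \<in> F") (auto simp: P_def rep_def rsubmodule_def)
  qed
  have "rmod_hom R M M (P i)" if i: "i \<in> I" for i
    unfolding rmod_hom_def
  proof (intro conjI ballI funcsetI)
    fix a assume a: "a \<in> carrier M"
    then obtain F where F: "rep a F (X a)" using X by blast
    show "P i a \<in> carrier M" using repc(3)[OF F] by (simp add: P_def)
    show "P i (ract M a r) = ract M (P i a) r" if r: "r \<in> carrier R" for r
    proof -
      have "rep (ract M a r) F (\<lambda>i. ract M (X a i) r)"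
        unfolding rep_def
      proof (intro conjI ballI allI impI)
        show "ract M a r = finsum M (\<lambda>i. ract M (X a i) r) F"
          using F ract_finsum[OF r _ repc(1)[OF F]] by (simp add: rep_def)
        show "ract M (X a i) r \<in> S i" if "i \<in> F" for i
          using F r that S[of i] by (auto simp: rep_def rsubmodule_def)
      qed (use F r in \<open>auto simp: rep_def ract_zero\<close>)
      from XI[OF this] show ?thesis by (simp add: P_def)
    qed
    fix b assume b: "b \<in> carrier M"
    then obtain G where "rep b G (X b)" using X by blast
    with F obtain H where H: "rep a H (X a)" "rep b H (X b)" using common by blast
    have "rep (a \<oplus>\<^bsub>M\<^esub> b) H (\<lambda>i. X a i \<oplus>\<^bsub>M\<^esub> X b i)"
      unfolding rep_def
    proof (intro conjI ballI allI impI)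
      show "a \<oplus>\<^bsub>M\<^esub> b = finsum M (\<lambda>i. X a i \<oplus>\<^bsub>M\<^esub> X b i) H"
        using H finsum_addf[OF repc(1)[OF H(1)] repc(1)[OF H(2)]] by (simp add: rep_def)
      show "X a i \<oplus>\<^bsub>M\<^esub> X b i \<in> S i" if "i \<in> H" for i
        using H that S[of i] by (auto simp: rep_def rsubmodule_def)
    qed (use H in \<open>auto simp: rep_def\<close>)
    from XI[OF this] show "P i (a \<oplus>\<^bsub>M\<^esub> b) = P i a \<oplus>\<^bsub>M\<^esub> P i b" by (simp add: P_def)
  qed
  moreover have "P i x = (if i = k then x else \<zero>\<^bsub>M\<^esub>)" if "k \<in> I" "x \<in> S k" for i k x
  proof -
    have "x \<in> carrier M" using S[OF that(1)] that(2) by (auto simp: rsubmodule_def)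
    then have "rep x {k} (\<lambda>i. if i = k then x else \<zero>\<^bsub>M\<^esub>)"
      using that by (auto simp: rep_def)
    from XI[OF this] show ?thesis by (simp add: P_def)
  qed
  moreover have "\<exists>F. finite F \<and> F \<subseteq> I \<and> a = finsum M (\<lambda>i. P i a) F" if "a \<in> carrier M" for a
    using X[OF that] by (auto simp: P_def rep_def)
  ultimately have "dsum_projections R M I S P"
    using PS unfolding dsum_projections_def by blast
  with that show ?thesis by blast
qed

end

subsection \<open>Exchange in terms of endomorphisms\<close>

text \<open>Since \<open>q j = 1\<close>, the endomorphism \<open>j q\<close> is idempotent with
  image \<open>j M\<close> and the same kernel as \<open>q\<close>; the two projections are
  \<open>j q\<close> and \<open>1 - j q\<close>.\<close>

lemma inner_dsum_retract:
  assumes "rmod R M" "rmod R A"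
    and j: "rmod_hom R M A j" and q: "rmod_hom R A M q"
    and qj: "\<And>m. m \<in> carrier M \<Longrightarrow> q (j m) = m"
  shows "inner_dsum A (UNIV :: bool set)
    (\<lambda>b. if b then j ` carrier M else {a \<in> carrier A. q a = \<zero>\<^bsub>M\<^esub>})"
proof -
  interpret M: rmod R M by fact
  interpret A: rmod R A by fact
  interpret MA: rmod_pair R M A by unfold_locales
  interpret AM: rmod_pair R A M by unfold_locales
  interpret AA: rmod_pair R A A by unfold_locales
  note jc = rmod_hom_closed[OF j] and qc = rmod_hom_closed[OF q]
  have jq: "rmod_hom R A A (\<lambda>a. j (q a))"
    by (rule rmod_hom_compose[OF q j])
  have jq': "rmod_hom R A A (\<lambda>a. a \<ominus>\<^bsub>A\<^esub> j (q a))"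
    by (intro AA.minus_hom rmod_hom_ident jq)
  have sum: "a = finsum A (\<lambda>b. if b then j (q a) else a \<ominus>\<^bsub>A\<^esub> j (q a)) (UNIV :: bool set)"
    if "a \<in> carrier A" for a
    using that jc qc A.minus_minus_self[of a "j (q a)"]
    by (simp add: UNIV_bool A.a_comm)
  have "dsum_projections R A (UNIV :: bool set)
      (\<lambda>b. if b then j ` carrier M else {a \<in> carrier A. q a = \<zero>\<^bsub>M\<^esub>})
      (\<lambda>b a. if b then j (q a) else a \<ominus>\<^bsub>A\<^esub> j (q a))"
    unfolding dsum_projections_def
  proof (intro conjI ballI)
    fix b :: bool
    show "rmod_hom R A A (\<lambda>a. if b then j (q a) else a \<ominus>\<^bsub>A\<^esub> j (q a))"
      using jq jq' by (cases b) simp_all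
    show "(if b then j (q a) else a \<ominus>\<^bsub>A\<^esub> j (q a)) \<in>
        (if b then j ` carrier M else {a \<in> carrier A. q a = \<zero>\<^bsub>M\<^esub>})" if "a \<in> carrier A" for a
      using that jc qc qj by (auto simp: AM.hom_minus[OF q] M.minus_eq M.r_neg)
    fix k :: bool and x
    assume "x \<in> (if k then j ` carrier M else {a \<in> carrier A. q a = \<zero>\<^bsub>M\<^esub>})"
    then show "(if b then j (q x) else x \<ominus>\<^bsub>A\<^esub> j (q x)) = (if b = k then x else \<zero>\<^bsub>A\<^esub>)"
      using jc qj MA.hom_zero[OF j]
      by (auto simp: A.minus_zero A.minus_eq A.r_neg split: if_splits)
  next
    fix a assume "a \<in> carrier A"
    from sum[OF this] show "\<exists>F. finite F \<and> F \<subseteq> (UNIV :: bool set) \<and>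
        a = finsum A (\<lambda>b. if b then j (q a) else a \<ominus>\<^bsub>A\<^esub> j (q a)) F"
      by (intro exI[of _ UNIV]) simp
  qed
  then show ?thesis
    by (rule A.inner_dsum_of_projections) (auto simp: jc)
qed

text \<open>Exchange gives a complement of \<open>j M\<close> that is the direct sum of submodules
  \<open>S' i\<close> of \<open>P i A\<close>; \<open>r\<close> is the projection onto
  \<open>j M\<close> along it, read in \<open>M\<close>. Expanding \<open>P k a\<close> accordingly
  and applying first \<open>P i\<close> and then \<open>r\<close>, which kills \<open>S' i\<close>,
  yields \<open>r P\<^sub>i j r P\<^sub>k = r P\<^sub>i P\<^sub>k\<close>. Hence the
  \<open>r P\<^sub>i j\<close> are orthogonal idempotents of \<open>M\<close> with sum
  \<open>1\<close>.\<close>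

lemma finite_exchange_retraction:
  fixes A :: "('a, 'r) rmodule" and I :: "nat set"
  assumes "rmod R M" "rmod R A"
    and exch: "finite_exchange R M TYPE('a)"
    and I: "finite I"
    and P: "\<And>i. i \<in> I \<Longrightarrow> rmod_hom R A A (P i)"
    and orth: "\<And>i k a. i \<in> I \<Longrightarrow> k \<in> I \<Longrightarrow> a \<in> carrier A \<Longrightarrow>
      P i (P k a) = (if i = k then P k a else \<zero>\<^bsub>A\<^esub>)"
    and sum: "\<And>a. a \<in> carrier A \<Longrightarrow> a = finsum A (\<lambda>i. P i a) I"
    and j: "rmod_hom R M A j" and q: "rmod_hom R A M q"
    and qj: "\<And>m. m \<in> carrier M \<Longrightarrow> q (j m) = m"
  obtains r where "rmod_hom R A M r" "\<And>m. m \<in> carrier M \<Longrightarrow> r (j m) = m"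
    "\<And>i k a. i \<in> I \<Longrightarrow> k \<in> I \<Longrightarrow> a \<in> carrier A \<Longrightarrow>
      r (P i (j (r (P k a)))) = (if i = k then r (P k a) else \<zero>\<^bsub>M\<^esub>)"
proof -
  interpret M: rmod R M by fact
  interpret A: rmod R A by fact
  interpret MA: rmod_pair R M A by unfold_locales
  interpret AM: rmod_pair R A M by unfold_locales
  interpret AA: rmod_pair R A A by unfold_locales
  note jc = rmod_hom_closed[OF j] and qc = rmod_hom_closed[OF q] and Pc = rmod_hom_closed[OF P]
  define S where "S i = P i ` carrier A" for i
  have S: "rsubmodule R A (S i)" if "i \<in> I" for i
    unfolding S_def using P[OF that] by (rule AA.image_rsubmodule)
  have Sc: "S i \<subseteq> carrier A" if "i \<in> I" for i
    using S[OF that] by (simp add: rsubmodule_def)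
  have PS: "P i x = (if i = k then x else \<zero>\<^bsub>A\<^esub>)" if "i \<in> I" "k \<in> I" "x \<in> S k" for i k x
    using that orth by (auto simp: S_def)
  have "dsum_projections R A I S P"
    unfolding dsum_projections_def
  proof (intro conjI ballI)
    fix a assume "a \<in> carrier A"
    from sum[OF this] show "\<exists>F. finite F \<and> F \<subseteq> I \<and> a = finsum A (\<lambda>i. P i a) F"
      using I by (intro exI[of _ I]) simp
  next
    show "P i a \<in> S i" if "a \<in> carrier A" for i a
      using that by (simp add: S_def)
  qed (use P PS in blast)+
  then have dsum: "inner_dsum A I S"
    using Sc by (rule A.inner_dsum_of_projections)
  define N where "N = {a \<in> carrier A. q a = \<zero>\<^bsub>M\<^esub>}"
  have carr: "rsubmodule R A (carrier A)"
    by (auto simp: rsubmodule_def A.ract_closed)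
  have N: "rsubmodule R A N"
    unfolding N_def by (rule AM.kernel_rsubmodule[OF q carr])
  have inj: "inj_on j (carrier M)"
    using qj by (metis inj_onI)
  have bool_dsum: "inner_dsum A (UNIV :: bool set) (\<lambda>b. if b then j ` carrier M else N)"
    unfolding N_def by (rule inner_dsum_retract) (use assms in auto)
  obtain S' where S': "\<And>i. i \<in> I \<Longrightarrow> rsubmodule R A (S' i)" "\<And>i. i \<in> I \<Longrightarrow> S' i \<subseteq> S i"
    and dsum': "inner_dsum A (insert None (Some ` I))
      (\<lambda>o'. case o' of None \<Rightarrow> j ` carrier M | Some i \<Rightarrow> S' i)"
    using exch[unfolded has_exchange_def, rule_format, of A j N I S]
      A.right_module j inj N bool_dsum I S dsum by blast
  let ?J = "insert None (Some ` I)"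
  let ?T = "\<lambda>o'. case o' of None \<Rightarrow> j ` carrier M | Some i \<Rightarrow> S' i"
  have "rsubmodule R A (?T o')" if "o' \<in> ?J" for o'
    using that S'(1) MA.image_rsubmodule[OF j] by auto
  then obtain Q where Q: "dsum_projections R A ?J ?T Q"
    using A.projections_of_inner_dsum[OF dsum'] by blast
  have Qhom: "rmod_hom R A A (Q None)" and Qhom': "\<And>i. i \<in> I \<Longrightarrow> rmod_hom R A A (Q (Some i))"
    and QT: "\<And>a. a \<in> carrier A \<Longrightarrow> Q None a \<in> j ` carrier M"
    and QS: "\<And>i a. i \<in> I \<Longrightarrow> a \<in> carrier A \<Longrightarrow> Q (Some i) a \<in> S' i"
    and Qj: "\<And>m. m \<in> carrier M \<Longrightarrow> Q None (j m) = j m"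
    and QSome: "\<And>i x. i \<in> I \<Longrightarrow> x \<in> S' i \<Longrightarrow> Q None x = \<zero>\<^bsub>A\<^esub>"
    using Q by (auto simp: dsum_projections_def)
  \<comment> \<open>\<open>Q None\<close> discards the complement formed by the \<open>S' i\<close>,
    and on its image \<open>j M\<close> the map \<open>q\<close> inverts \<open>j\<close>.\<close>
  define r where "r a = q (Q None a)" for a
  have r: "rmod_hom R A M r"
    unfolding r_def by (rule rmod_hom_compose[OF Qhom q])
  note rc = rmod_hom_closed[OF r]
  have rj: "r (j m) = m" if "m \<in> carrier M" for m
    using that by (simp add: r_def Qj qj)
  have jr: "j (r a) = Q None a" if "a \<in> carrier A" for a
    using QT[OF that] by (auto simp: r_def qj)
  have rS': "r x = \<zero>\<^bsub>M\<^esub>" if "i \<in> I" "x \<in> S' i" for i x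
    using that QSome[OF that] by (simp add: r_def AM.hom_zero[OF q])
  have decomp: "a = j (r a) \<oplus>\<^bsub>A\<^esub> finsum A (\<lambda>i. Q (Some i) a) I" if a: "a \<in> carrier A" for a
  proof -
    obtain F where F: "finite F" "F \<subseteq> ?J" "a = finsum A (\<lambda>o'. Q o' a) F"
      "\<And>o'. o' \<in> ?J - F \<Longrightarrow> Q o' a = \<zero>\<^bsub>A\<^esub>"
      using A.dsum_projections_zero_outside[OF Q a] by blast
    have Qc: "Q o' a \<in> carrier A" if "o' \<in> ?J" for o'
      using that a Qhom Qhom' rmod_hom_closed by (metis image_iff insert_iff)
    have "finsum A (\<lambda>o'. Q o' a) ?J = finsum A (\<lambda>o'. Q o' a) F"
      using F(1,2,4) Qc I by (intro A.finsum_superset) auto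
    then have "a = finsum A (\<lambda>o'. Q o' a) ?J" using F(3) by simp
    also have "\<dots> = Q None a \<oplus>\<^bsub>A\<^esub> finsum A (\<lambda>o'. Q o' a) (Some ` I)"
      using I Qc by (intro A.finsum_insert) auto
    also have "finsum A (\<lambda>o'. Q o' a) (Some ` I) = finsum A (\<lambda>i. Q (Some i) a) I"
      using Qc by (intro A.finsum_reindex) auto
    finally show ?thesis using jr[OF a] by simp
  qed
  have "r (P i (j (r (P k a)))) = (if i = k then r (P k a) else \<zero>\<^bsub>M\<^esub>)"
    if i: "i \<in> I" and k: "k \<in> I" and a: "a \<in> carrier A" for i k a
  proof -
    let ?b = "P k a"
    have b: "?b \<in> carrier A" using Pc[OF k a] .
    have Qb: "Q (Some l) ?b \<in> carrier A" "Q (Some l) ?b \<in> S l" if "l \<in> I" for l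
      using QS[OF that b] S'(2)[OF that] Sc[OF that] by auto
    have fc: "(\<lambda>l. Q (Some l) ?b) \<in> I \<rightarrow> carrier A" using Qb by auto
    \<comment> \<open>Of the complement only the component in \<open>S' i\<close> survives
      \<open>P i\<close>, because each \<open>S' l\<close> lies in \<open>S l\<close>, the image of
      \<open>P l\<close>.\<close>
    have "P i ?b = P i (j (r ?b)) \<oplus>\<^bsub>A\<^esub> P i (finsum A (\<lambda>l. Q (Some l) ?b) I)"
      using decomp[OF b] rmod_hom_add[OF P[OF i]] fc rc[OF b] jc by (metis A.finsum_closed)
    also have "P i (finsum A (\<lambda>l. Q (Some l) ?b) I) = finsum A (\<lambda>l. P i (Q (Some l) ?b)) I"
      using AA.hom_finsum[OF P[OF i] I fc] .
    also have "\<dots> = finsum A (\<lambda>l. if i = l then Q (Some l) ?b else \<zero>\<^bsub>A\<^esub>) I"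
      using PS[OF i] Qb by (intro A.finsum_cong') auto
    also have "\<dots> = Q (Some i) ?b"
      using fc I i by (intro A.finsum_singleton)
    finally have eq: "P i ?b = P i (j (r ?b)) \<oplus>\<^bsub>A\<^esub> Q (Some i) ?b" .
    have "r (P i ?b) = r (P i (j (r ?b))) \<oplus>\<^bsub>M\<^esub> r (Q (Some i) ?b)"
      unfolding eq using Pc[OF i] rc[OF b] jc Qb[OF i] by (intro rmod_hom_add[OF r]) auto
    also have "r (Q (Some i) ?b) = \<zero>\<^bsub>M\<^esub>"
      using rS'[OF i QS[OF i b]] .
    finally have "r (P i ?b) = r (P i (j (r ?b)))"
      using Pc[OF i] rc jc b by simp
    then show ?thesis
      using orth[OF i k a] AM.hom_zero[OF r] by (auto split: if_splits)
  qed
  with r rj that show ?thesis by blast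
qed

text \<open>
  The idempotent \<open>f\<close> is the part of \<open>M\<close> that is still to be split; the outcome is \<open>f = e f + f'\<close> with
  \<open>e = c \<pi> \<iota>\<close>. The hypothesis on \<open>w\<close> says that \<open>(1 - f) M\<close> embeds as a summand into the part \<open>\<sigma> A\<close>
  already treated. Combined with the embedding of \<open>f M\<close> into \<open>(\<pi> + \<rho>) A\<close>, this gives a new copy
  \<open>j M\<close> of \<open>M\<close> in \<open>A\<close>, so exchange for the summand \<open>f M\<close> is obtained without leaving the type of \<open>A\<close>.
\<close>

lemma exchange_step:
  fixes A :: "('a, 'r) rmodule"
  assumes "rmod R M" "rmod R A"
    and exch: "finite_exchange R M TYPE('a)"
    and hom: "rmod_hom R A A \<sigma>" "rmod_hom R A A \<pi>" "rmod_hom R A A \<rho>"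
    and sum: "\<And>a. a \<in> carrier A \<Longrightarrow> a = \<sigma> a \<oplus>\<^bsub>A\<^esub> (\<pi> a \<oplus>\<^bsub>A\<^esub> \<rho> a)"
    and orth: "\<And>a. a \<in> carrier A \<Longrightarrow> \<sigma> (\<sigma> a) = \<sigma> a"
      "\<And>a. a \<in> carrier A \<Longrightarrow> \<pi> (\<pi> a) = \<pi> a"
      "\<And>a. a \<in> carrier A \<Longrightarrow> \<rho> (\<rho> a) = \<rho> a"
      "\<And>a. a \<in> carrier A \<Longrightarrow> \<sigma> (\<pi> a) = \<zero>\<^bsub>A\<^esub>"
      "\<And>a. a \<in> carrier A \<Longrightarrow> \<sigma> (\<rho> a) = \<zero>\<^bsub>A\<^esub>"
      "\<And>a. a \<in> carrier A \<Longrightarrow> \<pi> (\<sigma> a) = \<zero>\<^bsub>A\<^esub>"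
      "\<And>a. a \<in> carrier A \<Longrightarrow> \<pi> (\<rho> a) = \<zero>\<^bsub>A\<^esub>"
      "\<And>a. a \<in> carrier A \<Longrightarrow> \<rho> (\<sigma> a) = \<zero>\<^bsub>A\<^esub>"
      "\<And>a. a \<in> carrier A \<Longrightarrow> \<rho> (\<pi> a) = \<zero>\<^bsub>A\<^esub>"
    and \<iota>: "rmod_hom R M A \<iota>"
    and f: "rmod_hom R M M f" and ff: "\<And>m. m \<in> carrier M \<Longrightarrow> f (f m) = f m"
    and d: "rmod_hom R A M d" and fd: "\<And>a. a \<in> carrier A \<Longrightarrow> f (d a) = d a"
    and df: "\<And>m. m \<in> carrier M \<Longrightarrow> d (\<pi> (\<iota> (f m)) \<oplus>\<^bsub>A\<^esub> \<rho> (\<iota> (f m))) = f m"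
    and w: "rmod_hom R A M w" and wf: "\<And>m. m \<in> carrier M \<Longrightarrow> w (\<sigma> (\<iota> m)) = m \<ominus>\<^bsub>M\<^esub> f m"
  obtains c d' f' w' where
    "rmod_hom R A M c" "rmod_hom R M M f'" "rmod_hom R A M d'" "rmod_hom R A M w'"
    "\<And>a. a \<in> carrier A \<Longrightarrow> f (c a) = c a"
    "\<And>a. a \<in> carrier A \<Longrightarrow> c (\<pi> (\<iota> (c a))) = c a"
    "\<And>m. m \<in> carrier M \<Longrightarrow> c (\<pi> (\<iota> (f m))) \<oplus>\<^bsub>M\<^esub> f' m = f m"
    "\<And>m. m \<in> carrier M \<Longrightarrow> c (\<pi> (\<iota> (f' m))) = \<zero>\<^bsub>M\<^esub>"
    "\<And>m. m \<in> carrier M \<Longrightarrow> f (f' m) = f' m"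
    "\<And>m. m \<in> carrier M \<Longrightarrow> f' (f' m) = f' m"
    "\<And>a. a \<in> carrier A \<Longrightarrow> f' (d' a) = d' a"
    "\<And>m. m \<in> carrier M \<Longrightarrow> d' (\<rho> (\<iota> (f m))) = f' m"
    "\<And>m. m \<in> carrier M \<Longrightarrow> d' (\<rho> (\<iota> (f' m))) = f' m"
    "\<And>m. m \<in> carrier M \<Longrightarrow> w' (\<sigma> (\<iota> m) \<oplus>\<^bsub>A\<^esub> \<pi> (\<iota> m)) = m \<ominus>\<^bsub>M\<^esub> f' m"
proof -
  interpret M: rmod R M by fact
  interpret A: rmod R A by fact
  interpret MA: rmod_pair R M A by unfold_locales
  interpret AM: rmod_pair R A M by unfold_locales
  interpret AA: rmod_pair R A A by unfold_locales
  interpret MM: rmod_pair R M M by unfold_locales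
  note cl = rmod_hom_closed[OF hom(1)] rmod_hom_closed[OF hom(2)] rmod_hom_closed[OF hom(3)]
    rmod_hom_closed[OF \<iota>] rmod_hom_closed[OF f] rmod_hom_closed[OF d] rmod_hom_closed[OF w]
  note addh = rmod_hom_add[OF hom(1)] rmod_hom_add[OF hom(2)] rmod_hom_add[OF hom(3)]
    rmod_hom_add[OF \<iota>] rmod_hom_add[OF f] rmod_hom_add[OF d] rmod_hom_add[OF w]
  note zero = AA.hom_zero[OF hom(1)] AA.hom_zero[OF hom(2)] AA.hom_zero[OF hom(3)]
    MA.hom_zero[OF \<iota>] MM.hom_zero[OF f] AM.hom_zero[OF d] AM.hom_zero[OF w]
  define g0 where "g0 m = m \<ominus>\<^bsub>M\<^esub> f m" for m
  have g0: "rmod_hom R M M g0"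
    unfolding g0_def by (intro MM.minus_hom rmod_hom_ident f)
  note g0c = rmod_hom_closed[OF g0]
  have fg0: "f (g0 m) = \<zero>\<^bsub>M\<^esub>" if "m \<in> carrier M" for m
    using that by (simp add: g0_def MM.hom_minus[OF f] ff cl M.minus_eq_zero_iff)
  have g0f: "g0 (f m) = \<zero>\<^bsub>M\<^esub>" if "m \<in> carrier M" for m
    using that by (simp add: g0_def ff cl M.minus_eq_zero_iff)
  have g0_add_f: "g0 m \<oplus>\<^bsub>M\<^esub> f m = m" if "m \<in> carrier M" for m
    using that by (simp add: g0_def M.minus_minus_self cl)
  have wg0: "w (\<sigma> (\<iota> m)) = g0 m" if "m \<in> carrier M" for m
    using wf[OF that] by (simp add: g0_def)
  \<comment> \<open>The part \<open>(1 - f) m\<close> is embedded through the block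
    \<open>\<sigma>\<close> and \<open>f m\<close> through \<open>\<pi>\<close> and
    \<open>\<rho>\<close>, so that \<open>j\<close>, unlike \<open>\<iota>\<close>, keeps the two
    parts apart. The map \<open>q\<close> undoes this with \<open>w\<close> on the first part and
    \<open>d\<close> on the second.\<close>
  define j where "j m = \<sigma> (\<iota> (g0 m)) \<oplus>\<^bsub>A\<^esub> (\<pi> (\<iota> (f m)) \<oplus>\<^bsub>A\<^esub> \<rho> (\<iota> (f m)))" for m
  define q where "q a = g0 (w (\<sigma> a)) \<oplus>\<^bsub>M\<^esub> d (\<pi> a \<oplus>\<^bsub>A\<^esub> \<rho> a)" for a
  have j: "rmod_hom R M A j"
    unfolding j_def
    by (intro MA.add_hom rmod_hom_compose[OF _ hom(1)] rmod_hom_compose[OF _ hom(2)]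
        rmod_hom_compose[OF _ hom(3)] rmod_hom_compose[OF _ \<iota>] g0 f)
  have q: "rmod_hom R A M q"
    unfolding q_def
    by (intro AM.add_hom AA.add_hom rmod_hom_compose[OF _ g0] rmod_hom_compose[OF _ d]
        rmod_hom_compose[OF _ w] hom)
  note jc = rmod_hom_closed[OF j]
  have \<sigma>j: "\<sigma> (j m) = \<sigma> (\<iota> (g0 m))" and \<pi>j: "\<pi> (j m) = \<pi> (\<iota> (f m))"
    and \<rho>j: "\<rho> (j m) = \<rho> (\<iota> (f m))" if "m \<in> carrier M" for m
    using that by (simp_all add: j_def addh cl g0c orth)
  have qj: "q (j m) = m" if "m \<in> carrier M" for m
  proof -
    have "g0 (g0 m) = g0 m"
      using that fg0[OF that] g0c by (simp add: g0_def[of "g0 m"] M.minus_zero)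
    then show ?thesis
      using that by (simp add: q_def \<sigma>j \<pi>j \<rho>j wg0 df g0c g0_add_f)
  qed
  \<comment> \<open>The three blocks \<open>\<sigma>\<close>, \<open>\<pi>\<close>,
    \<open>\<rho>\<close> are numbered \<open>0, 1, 2\<close>, since exchange takes index sets of
    naturals.\<close>
  define P where "P i = (if i = 0 then \<sigma> else if i = 1 then \<pi> else \<rho>)" for i :: nat
  have P: "rmod_hom R A A (P i)" for i
    using hom by (simp add: P_def)
  have Porth: "P i (P k a) = (if i = k then P k a else \<zero>\<^bsub>A\<^esub>)"
    if "i \<in> {0, 1, 2}" "k \<in> {0, 1, 2}" "a \<in> carrier A" for i k a
    using that orth by (auto simp: P_def)
  have Psum: "a = finsum A (\<lambda>i. P i a) {0, 1, 2}" if "a \<in> carrier A" for a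
    using sum[OF that] that by (simp add: P_def cl)
  obtain r where r: "rmod_hom R A M r" and rj: "\<And>m. m \<in> carrier M \<Longrightarrow> r (j m) = m"
    and rP: "\<And>i k a. i \<in> {0, 1, 2} \<Longrightarrow> k \<in> {0, 1, 2} \<Longrightarrow> a \<in> carrier A \<Longrightarrow>
      r (P i (j (r (P k a)))) = (if i = k then r (P k a) else \<zero>\<^bsub>M\<^esub>)"
    by (rule finite_exchange_retraction[OF \<open>rmod R M\<close> \<open>rmod R A\<close> exch _ P Porth Psum j q qj])
      (assumption | simp only: finite.emptyI finite.insertI | blast)+
  note rc = rmod_hom_closed[OF r]
  \<comment> \<open>\<open>h\<close>, \<open>g\<close>, \<open>f'\<close> are the endomorphisms
    \<open>r \<sigma> j\<close>, \<open>r \<pi> j\<close>, \<open>r \<rho> j\<close>, written with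
    the block components of \<open>j\<close> inserted.\<close>
  define g where "g m = r (\<pi> (\<iota> (f m)))" for m
  define f' where "f' m = r (\<rho> (\<iota> (f m)))" for m
  define h where "h m = r (\<sigma> (\<iota> (g0 m)))" for m
  have g: "rmod_hom R M M g"
    unfolding g_def by (intro rmod_hom_compose[OF _ r] rmod_hom_compose[OF _ hom(2)]
        rmod_hom_compose[OF _ \<iota>] f)
  have f': "rmod_hom R M M f'"
    unfolding f'_def by (intro rmod_hom_compose[OF _ r] rmod_hom_compose[OF _ hom(3)]
        rmod_hom_compose[OF _ \<iota>] f)
  note gc = rmod_hom_closed[OF g] and f'c = rmod_hom_closed[OF f']
  have rPj: "r (\<sigma> (j m)) = h m" "r (\<pi> (j m)) = g m" "r (\<rho> (j m)) = f' m"
    if "m \<in> carrier M" for m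
    using that by (simp_all add: \<sigma>j \<pi>j \<rho>j g_def f'_def h_def)
  have idem: "g (g m) = g m" "f' (f' m) = f' m" "g (f' m) = \<zero>\<^bsub>M\<^esub>"
    "h (g m) = \<zero>\<^bsub>M\<^esub>" "h (f' m) = \<zero>\<^bsub>M\<^esub>" if m: "m \<in> carrier M" for m
    using rP[of 1 1 "j m"] rP[of 2 2 "j m"] rP[of 1 2 "j m"] rP[of 0 1 "j m"] rP[of 0 2 "j m"] m jc
    by (simp_all add: P_def rPj gc f'c)
  \<comment> \<open>The three idempotents \<open>h, g, f'\<close> sum to \<open>1\<close>; as \<open>h f = 0\<close>, this forces \<open>g + f' = f\<close>.\<close>
  have gf: "g (f m) = g m" and f'f: "f' (f m) = f' m" and hf: "h (f m) = \<zero>\<^bsub>M\<^esub>"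
    if "m \<in> carrier M" for m
    using that by (simp_all add: g_def f'_def h_def ff g0f zero AM.hom_zero[OF r])
  have one: "h m \<oplus>\<^bsub>M\<^esub> (g m \<oplus>\<^bsub>M\<^esub> f' m) = m" if m: "m \<in> carrier M" for m
  proof -
    have "m = r (j m)" using rj[OF m] by simp
    also have "\<dots> = r (\<sigma> (j m) \<oplus>\<^bsub>A\<^esub> (\<pi> (j m) \<oplus>\<^bsub>A\<^esub> \<rho> (j m)))"
      using sum[OF jc[OF m]] by (rule arg_cong)
    also have "\<dots> = h m \<oplus>\<^bsub>M\<^esub> (g m \<oplus>\<^bsub>M\<^esub> f' m)"
      using m jc cl by (simp add: rmod_hom_add[OF r] rPj)
    finally show ?thesis by simp
  qed
  have g_add_f': "g m \<oplus>\<^bsub>M\<^esub> f' m = f m" if "m \<in> carrier M" for m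
    using one[of "f m"] that by (simp add: gf f'f hf cl gc f'c)
  \<comment> \<open>On the image of \<open>g\<close>, where \<open>h\<close> vanishes,
    \<open>1 = h + g + f'\<close> becomes \<open>1 = g + f'\<close>, and the right side is
    \<open>f\<close>. The image of \<open>f'\<close> is treated alike.\<close>
  have fg: "f (g m) = g m" if m: "m \<in> carrier M" for m
    using g_add_f'[of "g m"] one[of "g m"] m by (simp add: idem gc f'c cl)
  have ff': "f (f' m) = f' m" if m: "m \<in> carrier M" for m
    using g_add_f'[of "f' m"] one[of "f' m"] m by (simp add: idem gc f'c cl)
  \<comment> \<open>Composing with \<open>g\<close> forces the values into \<open>g M\<close>, which
    lies in \<open>f M\<close>. There \<open>c \<pi> \<iota>\<close> acts as \<open>g\<close>, hence
    as the identity, which gives \<open>c \<pi> \<iota> c = c\<close>.\<close>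
  define c where "c a = g (r a)" for a
  define d' where "d' a = f' (r a)" for a
  \<comment> \<open>On \<open>\<sigma> \<iota> m + \<pi> \<iota> m\<close> the map \<open>w\<close>
    recovers \<open>(1 - f) m\<close> from the first block, while \<open>c\<close> on the second
    block sees all of \<open>m\<close>. The last term removes the contribution of
    \<open>(1 - f) m\<close>, which leaves \<open>(1 - f) m + g m = m - f' m\<close>.\<close>
  define w' where "w' a = (w (\<sigma> a) \<oplus>\<^bsub>M\<^esub> c (\<pi> a)) \<ominus>\<^bsub>M\<^esub> c (\<pi> (\<iota> (w (\<sigma> a))))" for a
  have c: "rmod_hom R A M c"
    unfolding c_def by (rule rmod_hom_compose[OF r g])
  have d': "rmod_hom R A M d'"
    unfolding d'_def by (rule rmod_hom_compose[OF r f'])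
  have w': "rmod_hom R A M w'"
    unfolding w'_def
    by (intro AM.minus_hom AM.add_hom rmod_hom_compose[OF _ c] rmod_hom_compose[OF _ w]
        rmod_hom_compose[OF _ hom(2)] rmod_hom_compose[OF _ \<iota>] hom)
  have c\<pi>\<iota>: "c (\<pi> (\<iota> (f m))) = g m" if "m \<in> carrier M" for m
    using that by (simp add: c_def g_def[symmetric] idem)
  have d'\<rho>\<iota>: "d' (\<rho> (\<iota> (f m))) = f' m" if "m \<in> carrier M" for m
    using that by (simp add: d'_def f'_def[symmetric] idem)
  have w'_eq: "w' (\<sigma> (\<iota> m) \<oplus>\<^bsub>A\<^esub> \<pi> (\<iota> m)) = m \<ominus>\<^bsub>M\<^esub> f' m" if m: "m \<in> carrier M" for m
  proof -
    note cc = rmod_hom_closed[OF c]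
    let ?e = "\<lambda>m. c (\<pi> (\<iota> m))"
    have ec: "?e x \<in> carrier M" if "x \<in> carrier M" for x
      using that by (simp add: cc cl)
    have "?e m = ?e (g0 m \<oplus>\<^bsub>M\<^esub> f m)"
      using m by (simp add: g0_add_f)
    also have "\<dots> = ?e (g0 m) \<oplus>\<^bsub>M\<^esub> ?e (f m)"
      using m by (simp add: addh cl g0c rmod_hom_add[OF c])
    finally have "?e m = ?e (g0 m) \<oplus>\<^bsub>M\<^esub> g m"
      using m by (simp add: c\<pi>\<iota>)
    then have "(g0 m \<oplus>\<^bsub>M\<^esub> ?e m) \<ominus>\<^bsub>M\<^esub> ?e (g0 m) = g0 m \<oplus>\<^bsub>M\<^esub> g m"
      using m ec[of "g0 m"] g0c gc
      by (simp add: M.minus_eq M.a_assoc M.a_comm[of "?e (g0 m)"] M.r_neg)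
    moreover have "w' (\<sigma> (\<iota> m) \<oplus>\<^bsub>A\<^esub> \<pi> (\<iota> m)) = (g0 m \<oplus>\<^bsub>M\<^esub> ?e m) \<ominus>\<^bsub>M\<^esub> ?e (g0 m)"
      using m by (simp add: w'_def addh cl orth wg0)
    moreover have "g0 m \<oplus>\<^bsub>M\<^esub> g m = m \<ominus>\<^bsub>M\<^esub> f' m"
      using m g_add_f'[OF m] g0_add_f[OF m] g0c gc f'c
      by (intro M.eq_minus_of_add) (simp_all add: M.a_assoc)
    ultimately show ?thesis by simp
  qed
  show ?thesis
  proof (rule that[OF c f' d' w'])
    show "c (\<pi> (\<iota> (c a))) = c a" if "a \<in> carrier A" for a
      using c\<pi>\<iota>[of "g (r a)"] that by (simp add: c_def fg idem rc gc)
    show "c (\<pi> (\<iota> (f' m))) = \<zero>\<^bsub>M\<^esub>" if "m \<in> carrier M" for m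
      using c\<pi>\<iota>[of "f' m"] that by (simp add: ff' idem f'c)
    show "d' (\<rho> (\<iota> (f' m))) = f' m" if "m \<in> carrier M" for m
      using d'\<rho>\<iota>[of "f' m"] that by (simp add: ff' idem f'c)
  qed (use c\<pi>\<iota> d'\<rho>\<iota> w'_eq g_add_f' ff' idem in \<open>simp_all add: c_def d'_def fg rc\<close>)
qed

text \<open>Injectivity makes the preimage of \<open>g x\<close> unique, so linearity can be checked
  after applying \<open>f\<close>. The lift serves to read a projection onto \<open>f M\<close> as a
  map into \<open>M\<close>, and to invert an injective endomorphism on maps that land in its
  image.\<close>

lemma rmod_hom_lift:
  assumes "rmod R L" "rmod R M" and f: "rmod_hom R M N f" "inj_on f (carrier M)"
    and g: "rmod_hom R L N g" "\<And>x. x \<in> carrier L \<Longrightarrow> g x \<in> f ` carrier M"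
  shows "rmod_hom R L M (\<lambda>x. inv_into (carrier M) f (g x))"
proof -
  interpret L: rmod R L by fact
  interpret M: rmod R M by fact
  let ?h = "\<lambda>x. inv_into (carrier M) f (g x)"
  have h: "?h x \<in> carrier M" "f (?h x) = g x" if "x \<in> carrier L" for x
    using g(2)[OF that] by (auto intro: inv_into_into f_inv_into_f)
  have eq: "?h x = y" if "x \<in> carrier L" "y \<in> carrier M" "f y = g x" for x y
    using that f(2) by (metis inv_into_f_f)
  show ?thesis
    unfolding rmod_hom_def
    by (intro conjI ballI funcsetI eq)
      (simp_all add: h L.ract_closed M.ract_closed rmod_hom_add[OF f(1)] rmod_hom_add[OF g(1)]
        rmod_hom_ract[OF f(1)] rmod_hom_ract[OF g(1)])
qed

text \<open>Exchange steps on the blocks before, at and after \<open>n\<close> produce idempotents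
  \<open>f n\<close> with \<open>f n = e n f n + f (Suc n)\<close>. Triangularity holds since
  \<open>c k\<close> takes values in \<open>f k M\<close>, which for \<open>i < k\<close> lies in
  \<open>f (Suc i) M\<close>, and \<open>e i\<close> kills the latter. An element killed by all
  \<open>e n\<close> is fixed by all \<open>f n\<close>; as \<open>f (Suc n)\<close> is computed
  from the tail of \<open>\<iota> m\<close> after \<open>n\<close>, it must be zero.\<close>

lemma triangular_idempotents:
  fixes M :: "('b, 'r, 'd) rmodule_scheme"
    and A :: "('a, 'r) rmodule" and \<pi> :: "nat \<Rightarrow> 'a \<Rightarrow> 'a"
  assumes "rmod R M" "rmod R A"
    and exch: "finite_exchange R M TYPE('a)"
    and \<pi>: "\<And>i. rmod_hom R A A (\<pi> i)"
    and orth: "\<And>i k a. a \<in> carrier A \<Longrightarrow> \<pi> i (\<pi> k a) = (if i = k then \<pi> k a else \<zero>\<^bsub>A\<^esub>)"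
    and supp: "\<And>a. a \<in> carrier A \<Longrightarrow>
      \<exists>n. (\<forall>i\<ge>n. \<pi> i a = \<zero>\<^bsub>A\<^esub>) \<and> a = finsum A (\<lambda>i. \<pi> i a) {..<n}"
    and \<iota>: "rmod_hom R M A \<iota>" and p: "rmod_hom R A M p"
    and p\<iota>: "\<And>m. m \<in> carrier M \<Longrightarrow> p (\<iota> m) = m"
  obtains c where "\<And>i. rmod_hom R A M (c i)"
    "\<And>i a. a \<in> carrier A \<Longrightarrow> c i (\<pi> i (\<iota> (c i a))) = c i a"
    "\<And>i k a. i < k \<Longrightarrow> a \<in> carrier A \<Longrightarrow> c i (\<pi> i (\<iota> (c k a))) = \<zero>\<^bsub>M\<^esub>"
    "\<And>m. m \<in> carrier M \<Longrightarrow> (\<And>i. c i (\<pi> i (\<iota> m)) = \<zero>\<^bsub>M\<^esub>) \<Longrightarrow> m = \<zero>\<^bsub>M\<^esub>"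
proof -
  interpret M: rmod R M by fact
  interpret A: rmod R A by fact
  interpret MA: rmod_pair R M A by unfold_locales
  interpret AM: rmod_pair R A M by unfold_locales
  interpret AA: rmod_pair R A A by unfold_locales
  note \<pi>c = rmod_hom_closed[OF \<pi>] and \<iota>c = rmod_hom_closed[OF \<iota>]

  \<comment> \<open>Truncations and tails of the decomposition\<close>
  define \<sigma> where "\<sigma> n a = finsum A (\<lambda>i. \<pi> i a) {..<n}" for n a
  define \<rho> where "\<rho> n a = a \<ominus>\<^bsub>A\<^esub> \<sigma> n a" for n a
  have \<sigma>c: "\<sigma> n a \<in> carrier A" if "a \<in> carrier A" for n a
    using that \<pi>c unfolding \<sigma>_def by (intro A.finsum_closed) auto
  have \<sigma>0: "\<sigma> 0 a = \<zero>\<^bsub>A\<^esub>" for a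
    by (simp add: \<sigma>_def)
  have \<sigma>Suc: "\<sigma> (Suc n) a = \<sigma> n a \<oplus>\<^bsub>A\<^esub> \<pi> n a" if "a \<in> carrier A" for n a
  proof -
    have "\<sigma> (Suc n) a = \<pi> n a \<oplus>\<^bsub>A\<^esub> \<sigma> n a"
      unfolding \<sigma>_def lessThan_Suc using that \<pi>c by (intro A.finsum_insert) auto
    then show ?thesis using that \<sigma>c \<pi>c by (simp add: A.a_comm)
  qed
  have \<sigma>: "rmod_hom R A A (\<sigma> n)" for n
  proof (induction n)
    case 0
    then show ?case using AA.zero_hom by (simp add: \<sigma>0[abs_def])
  next
    case (Suc n)
    from AA.add_hom[OF this \<pi>[of n]] show ?case
      by (simp add: rmod_hom_def \<sigma>Suc A.ract_closed cong: Pi_cong)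
  qed
  have \<pi>\<sigma>: "\<pi> i (\<sigma> n a) = (if i < n then \<pi> i a else \<zero>\<^bsub>A\<^esub>)" if a: "a \<in> carrier A" for i n a
  proof (induction n)
    case (Suc n)
    then show ?case
      using a by (auto simp: \<sigma>Suc \<sigma>c \<pi>c rmod_hom_add[OF \<pi>] orth less_Suc_eq)
  qed (simp add: \<sigma>0 AA.hom_zero[OF \<pi>])
  have \<sigma>\<pi>: "\<sigma> n (\<pi> k a) = (if k < n then \<pi> k a else \<zero>\<^bsub>A\<^esub>)" if a: "a \<in> carrier A" for k n a
  proof (induction n)
    case (Suc n)
    then show ?case
      using a by (auto simp: \<sigma>Suc \<sigma>c \<pi>c orth less_Suc_eq)
  qed (simp add: \<sigma>0)
  have \<sigma>\<sigma>: "\<sigma> n (\<sigma> m a) = \<sigma> n a" if "a \<in> carrier A" "n \<le> m" for n m a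
    using that(2)
  proof (induction n)
    case (Suc n)
    then show ?case using that(1) by (simp add: \<sigma>Suc \<sigma>c \<pi>\<sigma>)
  qed (simp add: \<sigma>0)
  have \<rho>: "rmod_hom R A A (\<rho> n)" for n
    unfolding \<rho>_def by (intro AA.minus_hom rmod_hom_ident \<sigma>)
  note \<rho>c = rmod_hom_closed[OF \<rho>]
  have \<rho>_split: "\<pi> n a \<oplus>\<^bsub>A\<^esub> \<rho> (Suc n) a = \<rho> n a" and sum: "a = \<sigma> n a \<oplus>\<^bsub>A\<^esub> (\<pi> n a \<oplus>\<^bsub>A\<^esub> \<rho> (Suc n) a)"
    if a: "a \<in> carrier A" for n a
  proof -
    have "\<rho> (Suc n) a \<oplus>\<^bsub>A\<^esub> (\<sigma> n a \<oplus>\<^bsub>A\<^esub> \<pi> n a) = a"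
      using a A.minus_minus_self[of a "\<sigma> (Suc n) a"] \<sigma>c \<pi>c by (simp add: \<rho>_def \<sigma>Suc)
    then have *: "(\<pi> n a \<oplus>\<^bsub>A\<^esub> \<rho> (Suc n) a) \<oplus>\<^bsub>A\<^esub> \<sigma> n a = a"
      using a \<rho>c \<sigma>c \<pi>c by (simp add: A.a_ac)
    then show "a = \<sigma> n a \<oplus>\<^bsub>A\<^esub> (\<pi> n a \<oplus>\<^bsub>A\<^esub> \<rho> (Suc n) a)"
      using a \<rho>c \<sigma>c \<pi>c by (simp add: A.a_comm)
    show "\<pi> n a \<oplus>\<^bsub>A\<^esub> \<rho> (Suc n) a = \<rho> n a"
      unfolding \<rho>_def[of n] using * a \<rho>c \<sigma>c \<pi>c by (intro A.eq_minus_of_add) auto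
  qed
  have \<sigma>\<rho>: "\<sigma> n (\<rho> m a) = \<zero>\<^bsub>A\<^esub>" if "a \<in> carrier A" "n \<le> m" for n m a
    using that by (simp add: \<rho>_def AA.hom_minus[OF \<sigma>] \<sigma>\<sigma> \<sigma>c A.minus_eq_zero_iff)
  have \<pi>\<rho>: "\<pi> n (\<rho> (Suc n) a) = \<zero>\<^bsub>A\<^esub>" if "a \<in> carrier A" for n a
    using that by (simp add: \<rho>_def AA.hom_minus[OF \<pi>] \<pi>\<sigma> \<sigma>c \<pi>c A.minus_eq_zero_iff)
  have \<rho>\<rho>: "\<rho> n (\<rho> n a) = \<rho> n a" if "a \<in> carrier A" for n a
    using that by (simp add: \<rho>_def[of n "\<rho> n a"] \<sigma>\<rho> \<rho>c A.minus_zero)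
  have \<rho>\<sigma>: "\<rho> (Suc n) (\<sigma> n a) = \<zero>\<^bsub>A\<^esub>" if "a \<in> carrier A" for n a
    using that by (simp add: \<rho>_def \<sigma>Suc \<sigma>\<sigma> \<pi>\<sigma> \<sigma>c \<pi>c A.minus_eq_zero_iff)
  have \<rho>\<pi>: "\<rho> (Suc n) (\<pi> n a) = \<zero>\<^bsub>A\<^esub>" if "a \<in> carrier A" for n a
    using that by (simp add: \<rho>_def \<sigma>\<pi> \<pi>c \<sigma>c A.minus_eq_zero_iff)

  \<comment> \<open>In the invariant, \<open>f\<close> factors through \<open>\<rho> n\<close> and \<open>1 - f\<close> factors through \<open>\<sigma> n\<close>; the former makes
    \<open>\<Inter> ker e\<^sub>n\<close> vanish, since \<open>\<rho> n (\<iota> m) = 0\<close> for large \<open>n\<close>.\<close>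
  define Inv where "Inv n s \<longleftrightarrow> (case s of (f, d, w) \<Rightarrow>
      rmod_hom R M M f \<and> rmod_hom R A M d \<and> rmod_hom R A M w \<and>
      (\<forall>m\<in>carrier M. f (f m) = f m \<and> d (\<rho> n (\<iota> (f m))) = f m \<and> w (\<sigma> n (\<iota> m)) = m \<ominus>\<^bsub>M\<^esub> f m) \<and>
      (\<forall>a\<in>carrier A. f (d a) = d a))" for n s
  define Rel where "Rel n s s' c \<longleftrightarrow> (case (s, s') of ((f, _, _), (f', d', _)) \<Rightarrow>
      rmod_hom R A M c \<and>
      (\<forall>a\<in>carrier A. f (c a) = c a \<and> c (\<pi> n (\<iota> (c a))) = c a) \<and>
      (\<forall>m\<in>carrier M. c (\<pi> n (\<iota> (f m))) \<oplus>\<^bsub>M\<^esub> f' m = f m \<and> c (\<pi> n (\<iota> (f' m))) = \<zero>\<^bsub>M\<^esub> \<and>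
        f (f' m) = f' m \<and> d' (\<rho> (Suc n) (\<iota> (f m))) = f' m))"
    for n and s s' :: "('b \<Rightarrow> 'b) \<times> ('a \<Rightarrow> 'b) \<times> ('a \<Rightarrow> 'b)" and c
  \<comment> \<open>The homomorphism \<open>c\<close> belongs to the passage between two states
    rather than to a state, so it is bound inside the relation of the dependent choice and selected
    afterwards.\<close>
  have "\<exists>X. \<forall>n. Inv n (X n) \<and> (\<exists>c. Rel n (X n) (X (Suc n)) c)"
  proof (rule dependent_nat_choice)
    \<comment> \<open>Initially \<open>f\<close> is the identity: \<open>\<rho> 0\<close> is the
      identity as well, so the retraction \<open>p\<close> serves as \<open>d\<close>, and
      \<open>\<sigma> 0 = 0\<close> permits \<open>w = 0\<close>.\<close>
    have "Inv 0 (\<lambda>m. m, p, \<lambda>a. \<zero>\<^bsub>M\<^esub>)"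
      using p p\<iota> AM.zero_hom
      by (simp add: Inv_def rmod_hom_ident \<rho>_def \<sigma>0 \<iota>c A.minus_zero M.minus_eq M.r_neg)
    then show "\<exists>s. Inv 0 s" by blast
  next
    fix s n assume "Inv n s"
    moreover obtain f d w where s: "s = (f, d, w)" by (cases s) auto
    ultimately have f: "rmod_hom R M M f" "\<And>m. m \<in> carrier M \<Longrightarrow> f (f m) = f m"
      and d: "rmod_hom R A M d" "\<And>a. a \<in> carrier A \<Longrightarrow> f (d a) = d a"
      and d\<rho>: "\<And>m. m \<in> carrier M \<Longrightarrow> d (\<rho> n (\<iota> (f m))) = f m"
      and w: "rmod_hom R A M w" "\<And>m. m \<in> carrier M \<Longrightarrow> w (\<sigma> n (\<iota> m)) = m \<ominus>\<^bsub>M\<^esub> f m"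
      by (auto simp: Inv_def)
    have df: "d (\<pi> n (\<iota> (f m)) \<oplus>\<^bsub>A\<^esub> \<rho> (Suc n) (\<iota> (f m))) = f m" if "m \<in> carrier M" for m
      using d\<rho>[OF that] that \<iota>c rmod_hom_closed[OF f(1)] by (simp add: \<rho>_split)
    have idem: "\<sigma> n (\<sigma> n a) = \<sigma> n a" "\<pi> n (\<pi> n a) = \<pi> n a" "\<rho> (Suc n) (\<rho> (Suc n) a) = \<rho> (Suc n) a"
      "\<sigma> n (\<pi> n a) = \<zero>\<^bsub>A\<^esub>" "\<sigma> n (\<rho> (Suc n) a) = \<zero>\<^bsub>A\<^esub>" "\<pi> n (\<sigma> n a) = \<zero>\<^bsub>A\<^esub>"
      if "a \<in> carrier A" for a
      using that by (simp_all add: \<sigma>\<sigma> orth \<rho>\<rho> \<sigma>\<pi> \<sigma>\<rho> \<pi>\<sigma>)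
    obtain c d' f' w' where step:
      "rmod_hom R A M c" "rmod_hom R M M f'" "rmod_hom R A M d'" "rmod_hom R A M w'"
      "\<And>a. a \<in> carrier A \<Longrightarrow> f (c a) = c a"
      "\<And>a. a \<in> carrier A \<Longrightarrow> c (\<pi> n (\<iota> (c a))) = c a"
      "\<And>m. m \<in> carrier M \<Longrightarrow> c (\<pi> n (\<iota> (f m))) \<oplus>\<^bsub>M\<^esub> f' m = f m"
      "\<And>m. m \<in> carrier M \<Longrightarrow> c (\<pi> n (\<iota> (f' m))) = \<zero>\<^bsub>M\<^esub>"
      "\<And>m. m \<in> carrier M \<Longrightarrow> f (f' m) = f' m"
      "\<And>m. m \<in> carrier M \<Longrightarrow> f' (f' m) = f' m"
      "\<And>a. a \<in> carrier A \<Longrightarrow> f' (d' a) = d' a"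
      "\<And>m. m \<in> carrier M \<Longrightarrow> d' (\<rho> (Suc n) (\<iota> (f m))) = f' m"
      "\<And>m. m \<in> carrier M \<Longrightarrow> d' (\<rho> (Suc n) (\<iota> (f' m))) = f' m"
      "\<And>m. m \<in> carrier M \<Longrightarrow> w' (\<sigma> n (\<iota> m) \<oplus>\<^bsub>A\<^esub> \<pi> n (\<iota> m)) = m \<ominus>\<^bsub>M\<^esub> f' m"
      by (rule exchange_step[OF \<open>rmod R M\<close> \<open>rmod R A\<close> exch \<sigma>[of n] \<pi>[of n] \<rho>[of "Suc n"] sum idem
            \<pi>\<rho> \<rho>\<sigma> \<rho>\<pi> \<iota> f d df w])
        (assumption | blast)+
    have "Inv (Suc n) (f', d', w')"
      using step \<iota>c by (simp add: Inv_def \<sigma>Suc)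
    moreover have "Rel n s (f', d', w') c"
      using step by (simp add: Rel_def s)
    ultimately show "\<exists>s'. Inv (Suc n) s' \<and> (\<exists>c. Rel n s s' c)" by blast
  qed
  then obtain X where "\<And>n. Inv n (X n)" and "\<And>n. \<exists>c. Rel n (X n) (X (Suc n)) c"
    by blast
  then obtain c where X: "\<And>n. Inv n (X n)" and Rel: "\<And>n. Rel n (X n) (X (Suc n)) (c n)"
    by metis
  define f where "f n = fst (X n)" for n
  define d where "d n = fst (snd (X n))" for n
  define w where "w n = snd (snd (X n))" for n
  have f: "rmod_hom R M M (f n)" and d: "rmod_hom R A M (d n)" and w: "rmod_hom R A M (w n)"
    and w\<sigma>: "\<And>m. m \<in> carrier M \<Longrightarrow> w n (\<sigma> n (\<iota> m)) = m \<ominus>\<^bsub>M\<^esub> f n m"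
    and ff: "\<And>m. m \<in> carrier M \<Longrightarrow> f n (f n m) = f n m" for n
    using X[of n] by (auto simp: Inv_def f_def d_def w_def split: prod.splits)
  have c: "rmod_hom R A M (c n)"
    and fc: "\<And>a. a \<in> carrier A \<Longrightarrow> f n (c n a) = c n a"
    and c\<pi>c: "\<And>a. a \<in> carrier A \<Longrightarrow> c n (\<pi> n (\<iota> (c n a))) = c n a"
    and split: "\<And>m. m \<in> carrier M \<Longrightarrow> c n (\<pi> n (\<iota> (f n m))) \<oplus>\<^bsub>M\<^esub> f (Suc n) m = f n m"
    and cf: "\<And>m. m \<in> carrier M \<Longrightarrow> c n (\<pi> n (\<iota> (f (Suc n) m))) = \<zero>\<^bsub>M\<^esub>"
    and fSuc: "\<And>m. m \<in> carrier M \<Longrightarrow> f n (f (Suc n) m) = f (Suc n) m"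
    and d\<rho>: "\<And>m. m \<in> carrier M \<Longrightarrow> d (Suc n) (\<rho> (Suc n) (\<iota> (f n m))) = f (Suc n) m" for n
    using Rel[of n] by (auto simp: Rel_def f_def d_def split: prod.splits)
  note fcl = rmod_hom_closed[OF f] and ccl = rmod_hom_closed[OF c]
  \<comment> \<open>The images of the \<open>f n\<close> form a descending chain, and each
    idempotent \<open>f n\<close> fixes the later images pointwise.\<close>
  have f_le: "f n (f k m) = f k m" if "n \<le> k" "m \<in> carrier M" for n k m
    using that
  proof (induction k arbitrary: m rule: dec_induct)
    case (step k)
    then show ?case
      using step.IH[OF fcl[OF step.prems, of "Suc k"]] by (simp add: fSuc)
  qed (simp add: ff)
  show ?thesis
  proof (rule that[OF c c\<pi>c])
    fix i k :: nat and a assume "i < k" and a: "a \<in> carrier A"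
    \<comment> \<open>The value lies in \<open>f k M\<close>, hence in \<open>f (Suc i) M\<close> as
      \<open>Suc i \<le> k\<close>; this is the part left over after step \<open>i\<close>, the one
      that \<open>cf\<close> kills.\<close>
    then have "c k a = f (Suc i) (c k a)"
      using f_le[of "Suc i" k "c k a"] fc[OF a, of k] ccl[OF a] by simp
    then show "c i (\<pi> i (\<iota> (c k a))) = \<zero>\<^bsub>M\<^esub>"
      using cf[of "c k a" i] ccl[OF a] by simp
  next
    fix m assume m: "m \<in> carrier M" and 0: "\<And>i. c i (\<pi> i (\<iota> m)) = \<zero>\<^bsub>M\<^esub>"
    \<comment> \<open>The chosen sequence satisfies the invariant but its first state is not
      recorded; \<open>f 0 m = m\<close> is recovered from the clause for \<open>w\<close>, because
      \<open>\<sigma> 0 = 0\<close>.\<close>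
    have "\<zero>\<^bsub>M\<^esub> = m \<ominus>\<^bsub>M\<^esub> f 0 m"
      using w\<sigma>[OF m, of 0] AM.hom_zero[OF w] by (simp add: \<sigma>0)
    then have f0: "f 0 m = m"
      using m fcl M.minus_eq_zero_iff[of m "f 0 m"] by simp
    have fm: "f n m = m" for n
    proof (induction n)
      case (Suc n)
      then show ?case using split[OF m, of n] 0[of n] fcl[OF m] by simp
    qed (rule f0)
    obtain n where n: "\<forall>i\<ge>n. \<pi> i (\<iota> m) = \<zero>\<^bsub>A\<^esub>" "\<iota> m = \<sigma> n (\<iota> m)"
      using supp[OF \<iota>c[OF m]] by (auto simp: \<sigma>_def)
    \<comment> \<open>The shift to \<open>Suc n\<close> matches \<open>d\<rho>\<close>, which uses
      the tail after \<open>n\<close>; component \<open>n\<close> is already zero, so the truncation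
      is unchanged.\<close>
    have "\<sigma> (Suc n) (\<iota> m) = \<iota> m"
      using n m \<iota>c by (simp add: \<sigma>Suc)
    then have "\<rho> (Suc n) (\<iota> m) = \<zero>\<^bsub>A\<^esub>"
      using \<iota>c[OF m] by (simp add: \<rho>_def A.minus_eq_zero_iff)
    then show "m = \<zero>\<^bsub>M\<^esub>"
      using d\<rho>[OF m, of n] AM.hom_zero[OF d] by (simp add: fm)
  qed
qed

subsection \<open>Cohopfian modules\<close>

text \<open>Induction from the lowest index. Applied to the vanishing sum, \<open>e i\<close> kills
  the terms above \<open>i\<close> by \<open>tri\<close>, those below \<open>i\<close> are already
  zero, and the \<open>i\<close>-th term is reproduced by \<open>diag\<close>.\<close>

lemma triangular_independent:
  fixes \<pi> :: "nat \<Rightarrow> 'a \<Rightarrow> 'a"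
  assumes "rmod R M" "rmod R A"
    and \<pi>: "\<And>i. rmod_hom R A A (\<pi> i)" and \<iota>: "rmod_hom R M A \<iota>" and c: "\<And>i. rmod_hom R A M (c i)"
    and diag: "\<And>i a. a \<in> carrier A \<Longrightarrow> c i (\<pi> i (\<iota> (c i a))) = c i a"
    and tri: "\<And>i k a. i < k \<Longrightarrow> a \<in> carrier A \<Longrightarrow> c i (\<pi> i (\<iota> (c k a))) = \<zero>\<^bsub>M\<^esub>"
    and z: "\<And>i. z i \<in> carrier A" and sum: "finsum M (\<lambda>i. c i (z i)) {..<n} = \<zero>\<^bsub>M\<^esub>"
    and "i < n"
  shows "c i (z i) = \<zero>\<^bsub>M\<^esub>"
  using \<open>i < n\<close>
proof (induction i rule: less_induct)
  case (less i)
  interpret M: rmod R M by fact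
  interpret A: rmod R A by fact
  interpret MM: rmod_pair R M M by unfold_locales
  let ?e = "\<lambda>m. c i (\<pi> i (\<iota> m))"
  have e: "rmod_hom R M M ?e"
    by (intro rmod_hom_compose[OF _ c] rmod_hom_compose[OF _ \<pi>] \<iota>)
  have cz: "c k (z k) \<in> carrier M" for k
    using rmod_hom_closed[OF c z] .
  note ec = rmod_hom_closed[OF e cz]
  have off: "?e (c k (z k)) = \<zero>\<^bsub>M\<^esub>" if "k \<noteq> i" "k < n" for k
    using that less.IH[of k] tri[OF _ z, of i k] MM.hom_zero[OF e]
    by (cases "k < i") auto
  have "\<zero>\<^bsub>M\<^esub> = ?e (finsum M (\<lambda>k. c k (z k)) {..<n})"
    using MM.hom_zero[OF e] by (simp add: sum)
  also have "\<dots> = finsum M (\<lambda>k. ?e (c k (z k))) {..<n}"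
    using cz by (intro MM.hom_finsum[OF e]) auto
  also have "\<dots> = finsum M (\<lambda>k. ?e (c k (z k))) {i}"
    using off ec less.prems by (intro M.finsum_superset) auto
  also have "\<dots> = c i (z i)"
    using ec[of i] diag[OF z, of i] by simp
  finally show ?case by simp
qed

text \<open>The complement of \<open>\<iota> M\<close> is \<open>ker s\<close>. It splits along the
  given decomposition because \<open>s a = 0\<close> forces every \<open>c i (\<pi> i a)\<close> to
  vanish, so that for \<open>i\<close> in \<open>I\<close> the component \<open>\<pi> i a\<close>
  itself lies in the intersection of \<open>S i\<close> with the kernel of
  \<open>c i\<close>.\<close>

lemma cohopfian_exchange_nat:
  fixes M :: "('b, 'r, 'd) rmodule_scheme"
    and A :: "('a, 'r) rmodule" and I :: "nat set"
  assumes "rmod R M" "rmod R A"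
    and cohopf: "cohopfian R M"
    and exch: "finite_exchange R M TYPE('a)"
    and \<iota>: "rmod_hom R M A \<iota>" and inj: "inj_on \<iota> (carrier M)"
    and N: "rsubmodule R A N"
    and dsumN: "inner_dsum A (UNIV :: bool set) (\<lambda>b. if b then \<iota> ` carrier M else N)"
    and S: "\<And>i. i \<in> I \<Longrightarrow> rsubmodule R A (S i)" and dsumS: "inner_dsum A I S"
  obtains T where "\<And>i. i \<in> I \<Longrightarrow> rsubmodule R A (T i)" "\<And>i. i \<in> I \<Longrightarrow> T i \<subseteq> S i"
    "inner_dsum A (insert None (Some ` I)) (\<lambda>o'. case o' of None \<Rightarrow> \<iota> ` carrier M | Some i \<Rightarrow> T i)"
proof -
  interpret M: rmod R M by fact
  interpret A: rmod R A by fact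
  interpret MA: rmod_pair R M A by unfold_locales
  interpret AM: rmod_pair R A M by unfold_locales
  interpret AA: rmod_pair R A A by unfold_locales
  interpret MM: rmod_pair R M M by unfold_locales
  note \<iota>c = rmod_hom_closed[OF \<iota>]

  \<comment> \<open>Retraction onto the embedded module\<close>
  have "rsubmodule R A (if b then \<iota> ` carrier M else N)" for b
    using N MA.image_rsubmodule[OF \<iota>] by simp
  then obtain Q where Q: "dsum_projections R A (UNIV :: bool set)
      (\<lambda>b. if b then \<iota> ` carrier M else N) Q"
    using A.projections_of_inner_dsum[OF dsumN] by blast
  have Qhom: "rmod_hom R A A (Q True)" and QT: "\<And>a. a \<in> carrier A \<Longrightarrow> Q True a \<in> \<iota> ` carrier M"
    and Q\<iota>: "\<And>m. m \<in> carrier M \<Longrightarrow> Q True (\<iota> m) = \<iota> m"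
    using Q by (simp_all add: dsum_projections_def all_bool_eq)
  define p where "p a = inv_into (carrier M) \<iota> (Q True a)" for a
  have p: "rmod_hom R A M p"
    unfolding p_def by (rule rmod_hom_lift[OF assms(2,1) \<iota> inj Qhom QT])
  have p\<iota>: "p (\<iota> m) = m" if "m \<in> carrier M" for m
    using that inj by (simp add: p_def Q\<iota>)

  \<comment> \<open>Component projections indexed by all naturals\<close>
  obtain P where P: "dsum_projections R A I S P"
    using A.projections_of_inner_dsum[OF dsumS S] by blast
  \<comment> \<open>Indices outside \<open>I\<close> receive the zero projection, so that the
    recursion can run through all naturals.\<close>
  define \<pi> where "\<pi> i = (if i \<in> I then P i else (\<lambda>a. \<zero>\<^bsub>A\<^esub>))" for i
  have \<pi>: "rmod_hom R A A (\<pi> i)" for i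
    using P AA.zero_hom by (simp add: \<pi>_def dsum_projections_def)
  note \<pi>c = rmod_hom_closed[OF \<pi>]
  have Sc: "x \<in> carrier A" if "i \<in> I" "x \<in> S i" for i x
    using S[OF that(1)] that(2) by (auto simp: rsubmodule_def)
  have \<pi>S: "\<pi> i a \<in> S i" if "i \<in> I" "a \<in> carrier A" for i a
    using P that by (simp add: \<pi>_def dsum_projections_def)
  have \<pi>_eq: "\<pi> i x = (if i = k then x else \<zero>\<^bsub>A\<^esub>)" if "k \<in> I" "x \<in> S k" for i k x
    using P that by (auto simp: \<pi>_def dsum_projections_def)
  have orth: "\<pi> i (\<pi> k a) = (if i = k then \<pi> k a else \<zero>\<^bsub>A\<^esub>)" if a: "a \<in> carrier A" for i k a
  proof (cases "k \<in> I")
    case True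
    then show ?thesis using \<pi>_eq \<pi>S a by blast
  next
    case False
    then show ?thesis using AA.hom_zero[OF \<pi>] by (simp add: \<pi>_def[of k])
  qed
  have supp: "\<exists>n. (\<forall>i\<ge>n. \<pi> i a = \<zero>\<^bsub>A\<^esub>) \<and> a = finsum A (\<lambda>i. \<pi> i a) {..<n}"
    if a: "a \<in> carrier A" for a
  proof -
    obtain F where F: "finite F" "F \<subseteq> I" "a = finsum A (\<lambda>i. P i a) F"
      "\<And>i. i \<in> I - F \<Longrightarrow> P i a = \<zero>\<^bsub>A\<^esub>"
      using A.dsum_projections_zero_outside[OF P a] by blast
    obtain n where n: "F \<subseteq> {..<n}"
      using finite_nat_bounded[OF F(1)] by blast
    have zero: "\<pi> i a = \<zero>\<^bsub>A\<^esub>" if "i \<notin> F" for i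
      using F(4) that by (simp add: \<pi>_def)
    have "a = finsum A (\<lambda>i. \<pi> i a) F"
      by (rule trans[OF F(3)], rule A.finsum_cong')
        (use F(2) \<pi>c[OF a] in \<open>auto simp: \<pi>_def subset_iff\<close>)
    also have "\<dots> = finsum A (\<lambda>i. \<pi> i a) {..<n}"
      using n zero \<pi>c[OF a] by (intro A.finsum_superset[symmetric]) auto
    finally have "a = finsum A (\<lambda>i. \<pi> i a) {..<n}" .
    moreover have "\<forall>i\<ge>n. \<pi> i a = \<zero>\<^bsub>A\<^esub>"
      using n zero by (meson leD lessThan_iff subsetD)
    ultimately show ?thesis by blast
  qed

  \<comment> \<open>The sum \<open>s\<close> and the bijectivity of \<open>s \<iota>\<close>\<close>
  obtain c where c: "\<And>i. rmod_hom R A M (c i)"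
    and diag: "\<And>i a. a \<in> carrier A \<Longrightarrow> c i (\<pi> i (\<iota> (c i a))) = c i a"
    and tri: "\<And>i k a. i < k \<Longrightarrow> a \<in> carrier A \<Longrightarrow> c i (\<pi> i (\<iota> (c k a))) = \<zero>\<^bsub>M\<^esub>"
    and joint: "\<And>m. m \<in> carrier M \<Longrightarrow> (\<And>i. c i (\<pi> i (\<iota> m)) = \<zero>\<^bsub>M\<^esub>) \<Longrightarrow> m = \<zero>\<^bsub>M\<^esub>"
    by (rule triangular_idempotents[OF assms(1,2) exch \<pi> orth supp \<iota> p p\<iota>])
      (assumption | blast)+
  have hom: "rmod_hom R A M (\<lambda>a. c i (\<pi> i a))" for i
    by (rule rmod_hom_compose[OF \<pi> c])
  have fin: "\<exists>n. \<forall>i\<ge>n. c i (\<pi> i a) = \<zero>\<^bsub>M\<^esub>" if "a \<in> carrier A" for a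
    using supp[OF that] AM.hom_zero[OF c] by fastforce
  obtain s where s: "rmod_hom R A M s"
    and s_eq: "\<And>a n. a \<in> carrier A \<Longrightarrow> (\<And>i. i \<ge> n \<Longrightarrow> c i (\<pi> i a) = \<zero>\<^bsub>M\<^esub>) \<Longrightarrow>
      s a = finsum M (\<lambda>i. c i (\<pi> i a)) {..<n}"
    by (rule AM.sum_hom[of "\<lambda>i a. c i (\<pi> i a)", OF hom fin]) (assumption | blast)+
  note sc = rmod_hom_closed[OF s]
  have s0: "c i (\<pi> i a) = \<zero>\<^bsub>M\<^esub>" if a: "a \<in> carrier A" and "s a = \<zero>\<^bsub>M\<^esub>" for a i
  proof -
    obtain n where n: "\<And>i. i \<ge> n \<Longrightarrow> c i (\<pi> i a) = \<zero>\<^bsub>M\<^esub>" using fin[OF a] by blast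
    have "finsum M (\<lambda>i. c i (\<pi> i a)) {..<n} = \<zero>\<^bsub>M\<^esub>"
      using s_eq[OF a n] that(2) by simp
    \<comment> \<open>Below \<open>n\<close> this is independence for the elements
      \<open>z i = \<pi> i a\<close>; from \<open>n\<close> on the terms are zero by the choice of
      \<open>n\<close>.\<close>
    then show ?thesis
      using triangular_independent[where z = "\<lambda>i. \<pi> i a" and n = n and i = i,
          OF assms(1,2) \<pi> \<iota> c diag tri \<pi>c[OF a]] n[of i]
      by (cases "i < n") auto
  qed
  have s\<iota>: "rmod_hom R M M (\<lambda>m. s (\<iota> m))"
    by (rule rmod_hom_compose[OF \<iota> s])
  have s\<iota>_inj: "inj_on (\<lambda>m. s (\<iota> m)) (carrier M)"
  proof (rule inj_onI)
    fix x y assume xy: "x \<in> carrier M" "y \<in> carrier M" "s (\<iota> x) = s (\<iota> y)"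
    then have "s (\<iota> (x \<ominus>\<^bsub>M\<^esub> y)) = \<zero>\<^bsub>M\<^esub>"
      using MM.hom_minus[OF s\<iota>] by (simp add: M.minus_eq_zero_iff sc \<iota>c)
    then have "x \<ominus>\<^bsub>M\<^esub> y = \<zero>\<^bsub>M\<^esub>"
      using xy s0[OF \<iota>c] joint by simp
    then show "x = y" using xy M.minus_eq_zero_iff by blast
  qed
  have surj: "(\<lambda>m. s (\<iota> m)) ` carrier M = carrier M"
    using cohopf s\<iota> s\<iota>_inj by (auto simp: cohopfian_def bij_betw_def)
  \<comment> \<open>The map \<open>(s \<iota>)^-1 s\<close>, defined on all of \<open>A\<close>
    because \<open>s \<iota>\<close> is onto; it is the retraction of \<open>\<iota>\<close> with
    kernel \<open>ker s\<close>.\<close>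
  define q where "q a = inv_into (carrier M) (\<lambda>m. s (\<iota> m)) (s a)" for a
  have q: "rmod_hom R A M q"
    unfolding q_def by (rule rmod_hom_lift[OF assms(2,1) s\<iota> s\<iota>_inj s]) (simp only: surj sc)
  note qc = rmod_hom_closed[OF q]
  have q\<iota>: "q (\<iota> m) = m" if "m \<in> carrier M" for m
    unfolding q_def using that s\<iota>_inj by (rule inv_into_f_f[rotated])
  have s\<iota>q: "s (\<iota> (q a)) = s a" if "a \<in> carrier A" for a
    unfolding q_def using sc[OF that] surj f_inv_into_f[of "s a" "\<lambda>m. s (\<iota> m)" "carrier M"] by simp

  \<comment> \<open>The complement \<open>ker s\<close> and its components\<close>
  define t where "t a = a \<ominus>\<^bsub>A\<^esub> \<iota> (q a)" for a
  have t: "rmod_hom R A A t"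
    unfolding t_def by (intro AA.minus_hom rmod_hom_ident rmod_hom_compose[OF q \<iota>])
  note tc = rmod_hom_closed[OF t]
  have st: "s (t a) = \<zero>\<^bsub>M\<^esub>" if "a \<in> carrier A" for a
    using that by (simp add: t_def AM.hom_minus[OF s] s\<iota>q \<iota>c qc sc M.minus_eq_zero_iff)
  define T where "T i = {x \<in> S i. c i x = \<zero>\<^bsub>M\<^esub>}" for i
  have T: "rsubmodule R A (T i)" if "i \<in> I" for i
    unfolding T_def using AM.kernel_rsubmodule[OF c S[OF that]] .
  have q0: "q x = \<zero>\<^bsub>M\<^esub>" if "k \<in> I" "x \<in> T k" for k x
  proof -
    have x: "x \<in> S k" "x \<in> carrier A" "c k x = \<zero>\<^bsub>M\<^esub>"
      using that Sc by (auto simp: T_def)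
    then have "c i (\<pi> i x) = \<zero>\<^bsub>M\<^esub>" for i
      using \<pi>_eq[OF that(1)] AM.hom_zero[OF c] by simp
    \<comment> \<open>Every term vanishes, so \<open>0\<close> is an admissible bound and the sum is
      empty.\<close>
    then have "s x = \<zero>\<^bsub>M\<^esub>"
      using s_eq[OF x(2), of 0] by simp
    then show ?thesis
      using q\<iota>[of "\<zero>\<^bsub>M\<^esub>"] by (simp add: q_def MA.hom_zero[OF \<iota>] AM.hom_zero[OF s])
  qed
  let ?J = "insert None (Some ` I)"
  let ?U = "\<lambda>o'. case o' of None \<Rightarrow> \<iota> ` carrier M | Some i \<Rightarrow> T i"
  \<comment> \<open>The new coordinates: \<open>\<iota> q\<close> projects onto
    \<open>\<iota> M\<close>, and \<open>t = 1 - \<iota> q\<close> projects onto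
    \<open>ker s\<close>, where the old component projections are applied.\<close>
  let ?V = "\<lambda>o' a. case o' of None \<Rightarrow> \<iota> (q a) | Some i \<Rightarrow> \<pi> i (t a)"
  have V: "rmod_hom R A A (?V o')" for o'
    using rmod_hom_compose[OF q \<iota>] rmod_hom_compose[OF t \<pi>] by (cases o') simp_all
  have "dsum_projections R A ?J ?U ?V"
    unfolding dsum_projections_def
  proof (intro conjI ballI V)
    show "?V o' a \<in> ?U o'" if "o' \<in> ?J" "a \<in> carrier A" for o' a
      using that qc tc \<pi>S s0[OF tc st] by (auto simp: T_def)
  next
    fix o' k x assume o': "o' \<in> ?J" and k: "k \<in> ?J" and x: "x \<in> ?U k"
    show "?V o' x = (if o' = k then x else \<zero>\<^bsub>A\<^esub>)"
    proof (cases k)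
      case None
      with x obtain m where m: "m \<in> carrier M" "x = \<iota> m" by auto
      then have "t x = \<zero>\<^bsub>A\<^esub>"
        by (simp add: t_def q\<iota> \<iota>c A.minus_eq_zero_iff)
      then show ?thesis
        using m None AA.hom_zero[OF \<pi>] by (cases o') (simp_all add: q\<iota>)
    next
      case (Some l)
      with k x have l: "l \<in> I" "x \<in> T l" by auto
      then have "x \<in> S l" "x \<in> carrier A" using Sc by (auto simp: T_def)
      moreover from this have "t x = x"
        using q0[OF l] by (simp add: t_def MA.hom_zero[OF \<iota>] A.minus_zero)
      ultimately show ?thesis
        using Some q0[OF l] \<pi>_eq[OF l(1)] MA.hom_zero[OF \<iota>] by (cases o') simp_all
    qed
  next
    fix a assume a: "a \<in> carrier A"
    obtain n where n: "\<forall>i\<ge>n. \<pi> i (t a) = \<zero>\<^bsub>A\<^esub>" "t a = finsum A (\<lambda>i. \<pi> i (t a)) {..<n}"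
      using supp[OF tc[OF a]] by blast
    let ?F = "{..<n} \<inter> I"
    have Vc: "?V o' a \<in> carrier A" for o'
      using rmod_hom_closed[OF V a] .
    have "finsum A (\<lambda>i. \<pi> i (t a)) {..<n} = finsum A (\<lambda>i. \<pi> i (t a)) ?F"
      using \<pi>c[OF tc[OF a]] by (intro A.finsum_superset) (auto simp: \<pi>_def)
    also have "\<dots> = finsum A (\<lambda>o'. ?V o' a) (Some ` ?F)"
      using A.finsum_reindex[of "\<lambda>o'. ?V o' a" Some ?F] Vc by auto
    finally have ta: "t a = finsum A (\<lambda>o'. ?V o' a) (Some ` ?F)"
      using n(2) by (rule trans[rotated])
    have "a = t a \<oplus>\<^bsub>A\<^esub> \<iota> (q a)"
      using a by (simp add: t_def A.minus_minus_self \<iota>c qc)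
    also have "\<dots> = \<iota> (q a) \<oplus>\<^bsub>A\<^esub> t a"
      using a by (simp add: A.a_comm \<iota>c qc tc)
    also have "\<dots> = ?V None a \<oplus>\<^bsub>A\<^esub> finsum A (\<lambda>o'. ?V o' a) (Some ` ?F)"
      using ta by simp
    also have "\<dots> = finsum A (\<lambda>o'. ?V o' a) (insert None (Some ` ?F))"
      using Vc \<iota>c[OF qc[OF a]] by (intro A.finsum_insert[symmetric]) auto
    finally show "\<exists>F. finite F \<and> F \<subseteq> ?J \<and> a = finsum A (\<lambda>o'. ?V o' a) F"
      by (intro exI[of _ "insert None (Some ` ?F)"]) auto
  qed
  then have "inner_dsum A ?J ?U"
  proof (rule A.inner_dsum_of_projections)
    show "?U o' \<subseteq> carrier A" if "o' \<in> ?J" for o'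
      using that \<iota>c Sc by (auto simp: T_def)
  qed
  with T show ?thesis
    by (intro that[of T]) (auto simp: T_def)
qed

theorem theorem5:
  fixes R :: "('r, 'c) ring_scheme" and M :: "('m, 'r, 'd) rmodule_scheme"
  assumes "ring R"
    and "right_module R M"
    and "cohopfian R M"
    and "finite_exchange R M TYPE('a)"
  shows "countable_exchange R M TYPE('a)"
  unfolding has_exchange_def
proof (intro allI impI, elim conjE)
  fix A :: "('a, 'r) rmodule" and f N and I :: "nat set" and S
  assume A: "right_module R A" and f: "rmod_hom R M A f" "inj_on f (carrier M)"
    and N: "rsubmodule R A N"
      "inner_dsum A (UNIV :: bool set) (\<lambda>b. if b then f ` carrier M else N)"
    and S: "\<forall>i\<in>I. rsubmodule R A (S i)" "inner_dsum A I S"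
  have "rmod R M" "rmod R A"
    using assms(2) A by (simp_all add: rmod_def)
  from cohopfian_exchange_nat[OF this assms(3,4) f N S(1)[rule_format] S(2)]
  obtain T where "\<And>i. i \<in> I \<Longrightarrow> rsubmodule R A (T i)" "\<And>i. i \<in> I \<Longrightarrow> T i \<subseteq> S i"
    "inner_dsum A (insert None (Some ` I)) (\<lambda>j. case j of None \<Rightarrow> f ` carrier M | Some i \<Rightarrow> T i)"
    by blast
  then show "\<exists>T. (\<forall>i\<in>I. rsubmodule R A (T i) \<and> T i \<subseteq> S i) \<and>
      inner_dsum A (insert None (Some ` I)) (\<lambda>j. case j of None \<Rightarrow> f ` carrier M | Some i \<Rightarrow> T i)"
    by (intro exI[of _ T]) simp
qed

end
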